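(* Let $1<p<+\infty$, let $p'$ be defined by $\frac1p+\frac1{p'}=1$, let $I_0$ be a bounded real interval of positive length, and let $C(p)=\left(\frac{p}{p-1}\right)^p=(p')^p$. For maps $\alpha:\mathscr D(I_0)\to\mathbb R^+$, $I\mapsto\alpha_I$, and $\lambda:\mathscr D(I_0)\to\mathbb R^+$, $I\mapsto\lambda_I$, consider the condition $$\text{(H)}\qquad \frac{1}{|I|}\sum_{K\subseteq I}\alpha_K\Big(\frac{1}{|K|}\sum_{J\subseteq K}\lambda_J\Big)^p\le \frac{1}{|I|}\sum_{K\subseteq I}\lambda_K<+\infty\qquad\text{for all } I\in\mathscr D(I_0),$$ and, for a constant $C>0$, the condition $$\text{(T}_C)\qquad \frac{1}{|I_0|}\sum_{I\subseteq I_0}\alpha_I\Big(\frac{1}{|I|}\sum_{J\subseteq I}\phi(J)\lambda_J^{1/p'}\Big)^p\le C\,\frac{1}{|I_0|}\sum_{I\subseteq I_0}\phi(I)^p\qquad\text{for all }\phi:\mathscr D(I_0)\to\mathbb R^+\text{ with }\phi\in l^p(\mathscr D(I_0)).$$ Then: (i) for all $\alpha,\lambda$, if (H) holds, then (T$_{C}$) holds with $C=C(p)$; (ii) the constant $C(p)$ in (i) is sharp, i.e. for every $0<C<C(p)$ there exist $\alpha,\lambda$ satisfying (H) for which (T$_C$) fails; (iii) for all $\alpha,\lambda$, if (T$_C$) holds with $C=1$, then (H) holds.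
   Context: $\mathbb R^+=(0,+\infty)$. $|I|$ denotes the length of the interval $I$. $\mathscr D(I_0)$ is the dyadic tree over $I_0$: the countable collection of intervals consisting of $I_0$ and of all intervals obtained from it by repeated bisection (each $I\in\mathscr D(I_0)$ has two children $I_-,I_+\in\mathscr D(I_0)$, its left and right halves, and there are $2^k$ intervals of length $2^{-k}|I_0|$ for each $k\ge0$). For $I\in\mathscr D(I_0)$, a sum $\sum_{J\subseteq I}$ means the sum over all $J\in\mathscr D(I)$, i.e. over all intervals of the tree that are $I$ or a descendant of $I$. $\phi\in l^p(\mathscr D(I_0))$ means $\sum_{I\subseteq I_0}|\phi(I)|^p<+\infty$. *)

theory Defs
  imports "HOL-Analysis.Analysis"
begin

abbreviation len :: "real set \<Rightarrow> real" where
  "len I \<equiv> measure lborel I"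

text \<open>An interval is a set of reals, of any endpoint type. The midpoint goes to the right half, so
  that the two halves partition the interval; only the lengths and the tree structure matter for
  the sums below.\<close>

definition midpt :: "real set \<Rightarrow> real" where
  "midpt I = (Inf I + Sup I) / 2"

definition left_half :: "real set \<Rightarrow> real set" where
  "left_half I = {x \<in> I. x < midpt I}"

definition right_half :: "real set \<Rightarrow> real set" where
  "right_half I = {x \<in> I. midpt I \<le> x}"

inductive_set dyadic :: "real set \<Rightarrow> real set set" for I0 :: "real set" where
  root: "I0 \<in> dyadic I0"
| left: "I \<in> dyadic I0 \<Longrightarrow> left_half I \<in> dyadic I0"
| right: "I \<in> dyadic I0 \<Longrightarrow> right_half I \<in> dyadic I0"

text \<open>Sums over the tree are taken in \<open>[0, \<infinity>]\<close>, so they always exist and divergence means the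
  value \<open>\<infinity>\<close>. The power is the real one, with \<open>\<infinity>\<close> to the power \<open>p\<close> equal to \<open>\<infinity>\<close>; it is used for
  \<open>p > 0\<close> only.\<close>

definition ennpowr :: "ennreal \<Rightarrow> real \<Rightarrow> ennreal" where
  "ennpowr x p = (if x = \<infinity> then \<infinity> else ennreal (enn2real x powr p))"

definition tree_avg :: "real set \<Rightarrow> (real set \<Rightarrow> ennreal) \<Rightarrow> ennreal" where
  "tree_avg I f = ennreal (1 / len I) * (\<Sum>\<^sub>\<infinity>K\<in>dyadic I. f K)"

definition cond_H :: "real \<Rightarrow> real set \<Rightarrow> (real set \<Rightarrow> real) \<Rightarrow> (real set \<Rightarrow> real) \<Rightarrow> bool" where
  "cond_H p I0 \<alpha> lam \<longleftrightarrow>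
    (\<forall>I\<in>dyadic I0.
      tree_avg I (\<lambda>K. ennreal (\<alpha> K) * ennpowr (tree_avg K (\<lambda>J. ennreal (lam J))) p)
        \<le> tree_avg I (\<lambda>K. ennreal (lam K))
      \<and> tree_avg I (\<lambda>K. ennreal (lam K)) < \<infinity>)"

definition in_lp :: "real \<Rightarrow> real set \<Rightarrow> (real set \<Rightarrow> real) \<Rightarrow> bool" where
  "in_lp p I0 \<phi> \<longleftrightarrow> (\<lambda>I. \<bar>\<phi> I\<bar> powr p) summable_on dyadic I0"

definition cond_T ::
    "real \<Rightarrow> real \<Rightarrow> real set \<Rightarrow> (real set \<Rightarrow> real) \<Rightarrow> (real set \<Rightarrow> real) \<Rightarrow> real \<Rightarrow> bool" where
  "cond_T p p' I0 \<alpha> lam C \<longleftrightarrow>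
    (\<forall>\<phi>. \<phi> \<in> dyadic I0 \<rightarrow> {0<..} \<longrightarrow> in_lp p I0 \<phi> \<longrightarrow>
      tree_avg I0 (\<lambda>I. ennreal (\<alpha> I) *
          ennpowr (tree_avg I (\<lambda>J. ennreal (\<phi> J * lam J powr (1 / p')))) p)
        \<le> ennreal C * tree_avg I0 (\<lambda>I. ennreal (\<phi> I powr p)))"

definition sharp_const :: "real \<Rightarrow> real" where
  "sharp_const p = (p / (p - 1)) powr p"

end

theory Submission
  imports Defs
begin

text \<open>Writing \<open>\<phi> = f * lam powr (1 / p)\<close>, (T) becomes a Carleson embedding theorem for the averages
  of \<open>f\<close> over the subtrees, with respect to the measure \<open>lam\<close> on the nodes, and (H) is the
  Carleson condition with constant 1. Part (i) follows from the Bellman function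
  \<open>F - S powr p / (mu + M / (p - 1)) powr (p - 1)\<close>, where \<open>F\<close>, \<open>S\<close>, \<open>mu\<close>, \<open>M\<close> are the subtree
  sums of \<open>f powr p * lam\<close>, \<open>f * lam\<close>, \<open>lam\<close> and of the Carleson weights; it is nonnegative
  by Hoelder and, by convexity of \<open>(s, d) \<mapsto> s powr p * d powr (1 - p)\<close>, it grows at every node by
  at least \<open>(p / (p - 1)) powr - p\<close> times the term of that node. For (ii), the equality case of (H)
  on a mass concentrated along one branch reduces the embedding to Hardy's inequality. For (iii),
  test (T) on \<open>\<phi> = lam powr (1 / p)\<close>, cut off outside finite pieces of a subtree.\<close>

section \<open>Dyadic intervals as nodes of the binary tree\<close>

definition half :: "bool \<Rightarrow> real set \<Rightarrow> real set" where
  "half b I = (if b then right_half I else left_half I)"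

text \<open>Words are read from the root: \<open>v @ [b]\<close> addresses a child of
  \<open>node I v\<close>, while \<open>b # v\<close> is the address \<open>v\<close> inside
  \<open>half b I\<close>. The first form serves the recursions down the tree, the second the
  self-similar example for sharpness.\<close>

definition node :: "real set \<Rightarrow> bool list \<Rightarrow> real set" where
  "node I v = foldl (\<lambda>K b. half b K) I v"

definition bounded_interval :: "real set \<Rightarrow> bool" where
  "bounded_interval I \<longleftrightarrow> is_interval I \<and> bounded I \<and> 0 < len I"

lemma node_Nil [simp]: "node I [] = I"
  by (simp add: node_def)

lemma node_Cons: "node I (b # v) = node (half b I) v"
  by (simp add: node_def)

lemma node_append: "node I (v @ w) = node (node I v) w"
  by (simp add: node_def)

text \<open>The endpoints may or may not belong to \<open>S\<close>. It is an open interval with at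
  most two points added, hence Borel, and its measure is squeezed between those of the open and the
  closed interval.\<close>

lemma len_sandwich:
  fixes a b :: real
  assumes "{a<..<b} \<subseteq> S" "S \<subseteq> {a..b}" "a \<le> b"
  shows "len S = b - a"
proof -
  have S: "S = {a<..<b} \<union> (S \<inter> {a, b})"
    using assms by force
  have fin: "finite (S \<inter> {a, b})"
    by simp
  have meas: "S \<in> sets lborel"
    using sets.Un[OF borel_open[OF open_greaterThanLessThan] borel_closed[OF finite_imp_closed[OF fin]], of a b]
    by (simp flip: S)
  have "emeasure lborel {a<..<b} \<le> emeasure lborel S"
    by (rule emeasure_mono) (use assms meas in auto)
  moreover have "emeasure lborel S \<le> emeasure lborel {a..b}"
    by (rule emeasure_mono) (use assms in auto)
  ultimately have "emeasure lborel S = ennreal (b - a)"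
    using assms by simp
  thus ?thesis
    using assms by (simp add: measure_def)
qed

lemma bounded_interval_bounds:
  assumes "bounded_interval I"
  shows "{Inf I<..<Sup I} \<subseteq> I" "I \<subseteq> {Inf I..Sup I}" "Inf I < Sup I" "len I = Sup I - Inf I"
proof -
  have I: "is_interval I" "bdd_below I" "bdd_above I" "I \<noteq> {}"
    using assms bounded_imp_bdd_below bounded_imp_bdd_above
    by (auto simp: bounded_interval_def)
  show sub: "{Inf I<..<Sup I} \<subseteq> I"
  proof
    fix x assume "x \<in> {Inf I<..<Sup I}"
    then obtain y z where "y \<in> I" "y < x" "z \<in> I" "x < z"
      using I by (auto simp: cInf_less_iff less_cSup_iff)
    thus "x \<in> I"
      using I(1) unfolding is_interval_1 by (meson less_imp_le)
  qed
  show sup: "I \<subseteq> {Inf I..Sup I}"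
    using I by (auto intro: cInf_lower cSup_upper)
  have le: "Inf I \<le> Sup I"
    using sup I(4) by fastforce
  show len: "len I = Sup I - Inf I"
    by (rule len_sandwich[OF sub sup le])
  show "Inf I < Sup I"
    using assms len by (simp add: bounded_interval_def)
qed

lemma half_subset: "half b I \<subseteq> I"
  by (auto simp: half_def left_half_def right_half_def)

lemma half_disjoint: "b \<noteq> c \<Longrightarrow> half b I \<inter> half c I = {}"
  by (auto simp: half_def left_half_def right_half_def)

lemma len_half:
  assumes "bounded_interval I"
  shows "len (half b I) = len I / 2"
proof -
  note I = bounded_interval_bounds[OF assms]
  define m where "m = midpt I"
  have m: "m = (Inf I + Sup I) / 2"
    by (simp add: m_def midpt_def)
  show ?thesis
  proof (cases b)
    case True
    have "len (right_half I) = Sup I - m"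
      by (rule len_sandwich)
        (use I m in \<open>force simp: right_half_def m_def[symmetric]\<close>)+
    thus ?thesis
      using True I(4) m by (simp add: half_def field_simps)
  next
    case False
    have "len (left_half I) = m - Inf I"
      by (rule len_sandwich)
        (use I m in \<open>force simp: left_half_def m_def[symmetric]\<close>)+
    thus ?thesis
      using False I(4) m by (simp add: half_def field_simps)
  qed
qed

lemma bounded_interval_half:
  assumes "bounded_interval I"
  shows "bounded_interval (half b I)"
proof -
  have "is_interval I"
    using assms by (simp add: bounded_interval_def)
  moreover have "half b I = I \<inter> (if b then {midpt I..} else {..<midpt I})"
    by (auto simp: half_def left_half_def right_half_def)
  ultimately have "is_interval (half b I)"
    by (simp add: is_interval_Int)
  moreover have "bounded (half b I)"
    using assms bounded_subset[OF _ half_subset] by (auto simp: bounded_interval_def)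
  ultimately show ?thesis
    using assms len_half[OF assms, of b] by (simp add: bounded_interval_def)
qed

lemma bounded_interval_node:
  "bounded_interval I \<Longrightarrow> bounded_interval (node I v)"
  by (induction v arbitrary: I) (auto simp: node_Cons bounded_interval_half)

lemma len_node:
  "bounded_interval I \<Longrightarrow> len (node I v) = len I / 2 ^ length v"
  by (induction v arbitrary: I) (auto simp: node_Cons bounded_interval_half len_half)

lemma node_subset: "node I v \<subseteq> I"
proof (induction v arbitrary: I)
  case (Cons b v)
  thus ?case
    using half_subset[of b I] by (auto simp: node_Cons)
qed simp

text \<open>The length of a node determines the length of its word. For words of equal length, the
  first differing letter would put the same nonempty interval into two disjoint halves. Sums over
  the set of intervals thereby become sums over words.\<close>

lemma inj_node:
  assumes "bounded_interval I"
  shows "inj (node I)"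
proof -
  have "v = w"
    if "length v = length w" "node I v = node I w" "bounded_interval I" for v w and I
    using that
  proof (induction v w arbitrary: I rule: list_induct2)
    case (Cons b v c w)
    have "node (half b I) v \<noteq> {}"
      using bounded_interval_node[OF bounded_interval_half[OF Cons.prems(2)], of b v]
      by (auto simp: bounded_interval_def)
    moreover have "node (half b I) v \<subseteq> half b I \<inter> half c I"
      using Cons.prems(1) node_subset[of "half b I" v] node_subset[of "half c I" w]
      by (auto simp: node_Cons)
    ultimately have "b = c"
      using half_disjoint[of b c I] by blast
    thus ?case
      using Cons by (auto simp: node_Cons bounded_interval_half)
  qed simp
  moreover have "length v = length w" if "node I v = node I w" for v w
  proof -
    have "len I / 2 ^ length v = len I / 2 ^ length w"
      using that len_node[OF assms] by metis
    thus ?thesis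
      using assms by (simp add: bounded_interval_def)
  qed
  ultimately show ?thesis
    using assms by (intro injI) metis
qed

lemma dyadic_eq_range_node: "dyadic I = range (node I)"
proof
  show "dyadic I \<subseteq> range (node I)"
  proof
    fix K assume "K \<in> dyadic I"
    thus "K \<in> range (node I)"
    proof induction
      case root
      show ?case using node_Nil by blast
    next
      case (left K)
      then obtain v where "K = node I v" by blast
      hence "left_half K = node I (v @ [False])"
        by (simp add: node_append node_Cons half_def)
      thus ?case by blast
    next
      case (right K)
      then obtain v where "K = node I v" by blast
      hence "right_half K = node I (v @ [True])"
        by (simp add: node_append node_Cons half_def)
      thus ?case by blast
    qed
  qed
  have "node I v \<in> dyadic I" for v
    by (induction v rule: rev_induct)
      (auto simp: node_append node_Cons half_def intro: dyadic.intros)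
  thus "range (node I) \<subseteq> dyadic I" by blast
qed

section \<open>Sums over subtrees of the binary tree\<close>

definition subtree_sum :: "(bool list \<Rightarrow> ennreal) \<Rightarrow> bool list \<Rightarrow> ennreal" where
  "subtree_sum g v = (\<Sum>\<^sub>\<infinity>w. g (v @ w))"

text \<open>Truncation to the first \<open>n\<close> levels below \<open>v\<close>, in recursive
  form so that bounds can be proved by induction on the depth. The general type covers real and
  extended values alike.\<close>

fun depth_sum :: "nat \<Rightarrow> (bool list \<Rightarrow> 'a::comm_monoid_add) \<Rightarrow> bool list \<Rightarrow> 'a" where
  "depth_sum 0 g v = 0"
| "depth_sum (Suc n) g v = g v + depth_sum n g (v @ [False]) + depth_sum n g (v @ [True])"

lemma tree_avg_node:
  assumes "bounded_interval I"
  shows "tree_avg (node I v) g =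
    ennreal (2 ^ length v / len I) * subtree_sum (\<lambda>w. g (node I w)) v"
proof -
  have "(\<Sum>\<^sub>\<infinity>K\<in>dyadic (node I v). g K) = (\<Sum>\<^sub>\<infinity>w. g (node (node I v) w))"
    unfolding dyadic_eq_range_node
    by (subst infsum_reindex[OF inj_node[OF bounded_interval_node[OF assms]]])
      (simp add: o_def)
  thus ?thesis
    by (simp add: tree_avg_def subtree_sum_def len_node[OF assms] node_append)
qed

lemma ennreal_summable_on:
  fixes f :: "'a \<Rightarrow> ennreal"
  shows "f summable_on A"
  by (rule nonneg_summable_on_complete) simp

lemma finite_lists_shorter: "finite {w :: bool list. length w < n}"
  by (rule finite_subset[OF _ finite_lists_length_le[of "UNIV :: bool set" n]]) auto

lemma lists_shorter_Suc:
  "{w :: bool list. length w < Suc n} =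
    insert [] (Cons False ` {w. length w < n} \<union> Cons True ` {w. length w < n})"
proof -
  have "w \<in> insert [] (Cons False ` {w. length w < n} \<union> Cons True ` {w. length w < n})"
    if "length w < Suc n" for w :: "bool list"
    using that by (cases w; cases "hd w") auto
  thus ?thesis by auto
qed

lemma depth_sum_eq_sum: "depth_sum n g v = (\<Sum>w | length w < n. g (v @ w))"
proof (induction n arbitrary: v)
  case (Suc n)
  let ?L = "{w :: bool list. length w < n}"
  have "(\<Sum>w | length w < Suc n. g (v @ w)) =
      g v + (\<Sum>w\<in>Cons False ` ?L \<union> Cons True ` ?L. g (v @ w))"
    unfolding lists_shorter_Suc by (subst sum.insert) (auto simp: finite_lists_shorter)
  also have "(\<Sum>w\<in>Cons False ` ?L \<union> Cons True ` ?L. g (v @ w)) =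
      (\<Sum>w\<in>?L. g (v @ False # w)) + (\<Sum>w\<in>?L. g (v @ True # w))"
    by (subst sum.union_disjoint) (auto simp: finite_lists_shorter sum.reindex)
  finally show ?case
    using Suc by (simp add: add.assoc)
qed simp

lemma depth_sum_le_subtree_sum: "depth_sum n g v \<le> subtree_sum g v"
proof -
  have "(\<Sum>w | length w < n. g (v @ w)) = (\<Sum>\<^sub>\<infinity>w\<in>{w. length w < n}. g (v @ w))"
    by (simp add: infsum_finite finite_lists_shorter)
  also have "\<dots> \<le> subtree_sum g v"
    unfolding subtree_sum_def by (rule infsum_mono_neutral) (auto simp: ennreal_summable_on)
  finally show ?thesis
    by (simp add: depth_sum_eq_sum)
qed

text \<open>The words of a finite set have bounded length, so its sum is dominated by a truncation.
  Upper bounds for subtree sums thus reduce to inductions on the depth.\<close>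

lemma subtree_sum_leI:
  assumes "\<And>n. depth_sum n g v \<le> B"
  shows "subtree_sum g v \<le> B"
  unfolding subtree_sum_def
proof (rule infsum_le_finite_sums)
  fix F :: "bool list set" assume "finite F"
  \<comment> \<open>The element 0 keeps \<open>Max\<close> meaningful when \<open>F\<close> is
    empty.\<close>
  have "F \<subseteq> {w. length w < Suc (Max (insert 0 (length ` F)))}"
    using \<open>finite F\<close> by (auto simp: less_Suc_eq_le)
  hence "(\<Sum>w\<in>F. g (v @ w)) \<le> depth_sum (Suc (Max (insert 0 (length ` F)))) g v"
    unfolding depth_sum_eq_sum by (intro sum_mono2 finite_lists_shorter) auto
  thus "(\<Sum>w\<in>F. g (v @ w)) \<le> B"
    using assms order_trans by blast
qed (rule ennreal_summable_on)

lemma depth_sum_mono_depth: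
  fixes g :: "bool list \<Rightarrow> 'a::ordered_comm_monoid_add"
  assumes "m \<le> n" "\<And>w. 0 \<le> g w"
  shows "depth_sum m g v \<le> depth_sum n g v"
  unfolding depth_sum_eq_sum
  by (rule sum_mono2) (use assms finite_lists_shorter in auto)

lemma subtree_sum_eq_SUP: "subtree_sum g v = (SUP n. depth_sum n g v)"
  by (intro antisym subtree_sum_leI SUP_least SUP_upper depth_sum_le_subtree_sum) auto

lemma depth_sum_tendsto: "(\<lambda>n. depth_sum n g v) \<longlonglongrightarrow> subtree_sum g v"
  unfolding subtree_sum_eq_SUP
  by (rule LIMSEQ_SUP) (simp add: incseq_def depth_sum_mono_depth)

text \<open>The recursion equation of \<open>depth_sum\<close> passes to the limit, as addition is
  continuous on the extended half-line.\<close>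

lemma subtree_sum_rec:
  "subtree_sum g v = g v + subtree_sum g (v @ [False]) + subtree_sum g (v @ [True])"
proof -
  have "(\<lambda>n. depth_sum (Suc n) g v) \<longlonglongrightarrow>
      g v + subtree_sum g (v @ [False]) + subtree_sum g (v @ [True])"
    by (auto intro!: tendsto_add depth_sum_tendsto)
  moreover have "(\<lambda>n. depth_sum (Suc n) g v) \<longlonglongrightarrow> subtree_sum g v"
    by (rule LIMSEQ_Suc[OF depth_sum_tendsto])
  ultimately show ?thesis
    using LIMSEQ_unique by blast
qed

lemma subtree_sum_mono: "(\<And>w. g w \<le> h w) \<Longrightarrow> subtree_sum g v \<le> subtree_sum h v"
  unfolding subtree_sum_def by (rule infsum_mono) (auto simp: ennreal_summable_on)

lemma subtree_sum_add:
  "subtree_sum (\<lambda>w. g w + h w) v = subtree_sum g v + subtree_sum h v"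
  unfolding subtree_sum_def by (rule infsum_add) (auto simp: ennreal_summable_on)

lemma subtree_sum_cmult: "subtree_sum (\<lambda>w. c * g w) v = c * subtree_sum g v"
  unfolding subtree_sum_def
  by (simp add: nonneg_infsum_complete SUP_mult_left_ennreal sum_distrib_left)

lemma subtree_sum_append_le: "subtree_sum g (v @ w) \<le> subtree_sum g v"
proof (induction w rule: rev_induct)
  case (snoc b w)
  have "subtree_sum g ((v @ w) @ [b]) \<le> subtree_sum g (v @ w)"
    by (subst (2) subtree_sum_rec) (cases b; auto intro: add_increasing add_increasing2)
  thus ?case
    using snoc by simp
qed simp

lemma subtree_sum_le_root: "subtree_sum g v \<le> subtree_sum g []"
  using subtree_sum_append_le[of g "[]" v] by simp

lemma le_subtree_sum: "g v \<le> subtree_sum g v"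
  using depth_sum_le_subtree_sum[of 1 g v] by simp

lemma depth_sum_nonneg:
  fixes g :: "bool list \<Rightarrow> 'a::ordered_comm_monoid_add"
  shows "(\<And>w. 0 \<le> g w) \<Longrightarrow> 0 \<le> depth_sum n g v"
  unfolding depth_sum_eq_sum by (rule sum_nonneg)

lemma ennreal_depth_sum:
  "(\<And>w. 0 \<le> g w) \<Longrightarrow> ennreal (depth_sum n g v) = depth_sum n (\<lambda>w. ennreal (g w)) v"
  unfolding depth_sum_eq_sum by simp

section \<open>Powers in the extended half-line\<close>

lemma ennpowr_ennreal: "0 \<le> x \<Longrightarrow> ennpowr (ennreal x) p = ennreal (x powr p)"
  by (simp add: ennpowr_def)

lemma ennpowr_mono: "x \<le> y \<Longrightarrow> 0 < p \<Longrightarrow> ennpowr x p \<le> ennpowr y p"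
  by (cases x; cases y) (auto simp: ennpowr_def top_unique intro!: powr_mono2)

lemma ennpowr_cmult:
  assumes "0 < c" "0 < p"
  shows "ennpowr (ennreal c * x) p = ennreal (c powr p) * ennpowr x p"
proof (cases x)
  case (real r)
  hence "ennreal c * x = ennreal (c * r)"
    using assms by (simp add: ennreal_mult)
  moreover have "ennpowr (ennreal (c * r)) p = ennreal (c powr p * r powr p)"
    using real assms by (subst ennpowr_ennreal) (simp_all add: powr_mult)
  ultimately show ?thesis
    using real assms by (simp add: ennpowr_ennreal ennreal_mult)
next
  case top
  thus ?thesis
    using assms by (simp add: ennpowr_def ennreal_mult_top)
qed

section \<open>The conditions on the binary tree\<close>

text \<open>The averages become plain sums: the outer factor \<open>1 / |I|\<close> cancels between
  the two sides, the inner ones move into the weight \<open>A\<close>.\<close>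

definition tree_H :: "real \<Rightarrow> (bool list \<Rightarrow> real) \<Rightarrow> (bool list \<Rightarrow> real) \<Rightarrow> bool" where
  "tree_H p A lam \<longleftrightarrow>
    (\<forall>v. subtree_sum (\<lambda>w. ennreal (A w) * ennpowr (subtree_sum (\<lambda>x. ennreal (lam x)) w) p) v
        \<le> subtree_sum (\<lambda>x. ennreal (lam x)) v
      \<and> subtree_sum (\<lambda>x. ennreal (lam x)) v < \<infinity>)"

definition tree_T ::
    "real \<Rightarrow> real \<Rightarrow> (bool list \<Rightarrow> real) \<Rightarrow> (bool list \<Rightarrow> real) \<Rightarrow> real \<Rightarrow> bool" where
  "tree_T p p' A lam C \<longleftrightarrow>
    (\<forall>f. (\<forall>v. 0 < f v) \<longrightarrow> subtree_sum (\<lambda>v. ennreal (f v powr p)) [] < \<infinity> \<longrightarrow>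
      subtree_sum (\<lambda>v. ennreal (A v) *
          ennpowr (subtree_sum (\<lambda>w. ennreal (f w * lam w powr (1 / p'))) v) p) []
        \<le> ennreal C * subtree_sum (\<lambda>v. ennreal (f v powr p)) [])"

text \<open>The factors \<open>1 / |K|\<close> inside the powers are absorbed into the weight \<open>\<alpha>\<close>.\<close>

definition tree_weight :: "real \<Rightarrow> real set \<Rightarrow> (real set \<Rightarrow> real) \<Rightarrow> bool list \<Rightarrow> real" where
  "tree_weight p I \<alpha> v = \<alpha> (node I v) * (2 ^ length v / len I) powr p"

lemma tree_avg_power_eq:
  assumes "bounded_interval I" "0 < p" "\<And>v. 0 \<le> \<alpha> (node I v)"
  shows "tree_avg (node I v) (\<lambda>K. ennreal (\<alpha> K) * ennpowr (tree_avg K g) p) =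
    ennreal (2 ^ length v / len I) * subtree_sum (\<lambda>w. ennreal (tree_weight p I \<alpha> w) *
      ennpowr (subtree_sum (\<lambda>x. g (node I x)) w) p) v"
proof -
  have pos: "0 < 2 ^ n / len I" for n
    using assms by (simp add: bounded_interval_def)
  show ?thesis
    unfolding tree_avg_node[OF assms(1)] ennpowr_cmult[OF pos assms(2)] tree_weight_def
    by (simp add: ennreal_mult assms(3) mult.assoc)
qed

lemma cond_H_iff_tree_H:
  assumes I: "bounded_interval I" and "0 < p" "\<And>v. 0 \<le> \<alpha> (node I v)"
  shows "cond_H p I \<alpha> lam \<longleftrightarrow> tree_H p (tree_weight p I \<alpha>) (\<lambda>v. lam (node I v))"
proof -
  have "ennreal (2 ^ n / len I) * x \<le> ennreal (2 ^ n / len I) * y \<longleftrightarrow> x \<le> y"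
    "ennreal (2 ^ n / len I) * x < \<infinity> \<longleftrightarrow> x < \<infinity>" for n x y
    using I by (auto simp: bounded_interval_def ennreal_mult_le_mult_iff ennreal_mult_less_top)
  thus ?thesis
    by (simp add: cond_H_def tree_H_def dyadic_eq_range_node assms
        tree_avg_power_eq[OF I, where \<alpha> = \<alpha>])
      (simp add: tree_avg_node[OF I])
qed

section \<open>The embedding theorem\<close>

definition persp :: "real \<Rightarrow> real \<Rightarrow> real \<Rightarrow> real" where
  "persp p s d = s powr p * d powr (1 - p)"

lemma persp_eq: "0 < s \<Longrightarrow> 0 < d \<Longrightarrow> persp p s d = d * (s / d) powr p"
  by (simp add: persp_def powr_divide powr_diff)

text \<open>\<open>persp p s d\<close> is the perspective \<open>d * (s / d) powr p\<close> of a
  convex function, hence convex and homogeneous of degree 1. Concretely,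
  \<open>(x + y) / (a + b)\<close> is the mean of \<open>x / a\<close> and \<open>y / b\<close> with
  weights proportional to \<open>a\<close> and \<open>b\<close>.\<close>

lemma persp_subadditive:
  assumes "1 \<le> p" "0 < x" "0 < y" "0 < a" "0 < b"
  shows "persp p (x + y) (a + b) \<le> persp p x a + persp p y b"
proof -
  define t where "t = b / (a + b)"
  have t: "0 \<le> t" "t \<le> 1" "1 - t = a / (a + b)"
    using assms by (auto simp: t_def field_simps)
  have "((1 - t) *\<^sub>R (x / a) + t *\<^sub>R (y / b)) powr p
      \<le> (1 - t) * (x / a) powr p + t * (y / b) powr p"
    by (rule convex_onD[OF powr_convex[OF assms(1)]]) (use assms t in auto)
  moreover have "(1 - t) *\<^sub>R (x / a) + t *\<^sub>R (y / b) = (x + y) / (a + b)"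
    using assms unfolding t(3) by (simp add: t_def add_divide_distrib)
  ultimately have "(a + b) * ((x + y) / (a + b)) powr p
      \<le> (a + b) * ((1 - t) * (x / a) powr p + t * (y / b) powr p)"
    using assms by (intro mult_left_mono) auto
  also have "\<dots> = a * (x / a) powr p + b * (y / b) powr p"
    using assms unfolding t(3) by (simp add: t_def distrib_left)
  finally show ?thesis
    using assms by (simp add: persp_eq)
qed

lemma persp_antimono:
  assumes "1 \<le> p" "0 < d" "d \<le> e"
  shows "persp p s e \<le> persp p s d"
  unfolding persp_def by (rule mult_left_mono) (use assms in \<open>auto intro: powr_mono2'\<close>)

text \<open>Mean value theorem in the second argument. The derivative
  \<open>(1 - p) * z powr - p\<close> is smallest in absolute value at the right end
  \<open>d + h\<close>.\<close>

lemma persp_decrease: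
  assumes "1 < p" "0 < d" "0 \<le> h"
  shows "s powr p * ((p - 1) * h * (d + h) powr - p) \<le> persp p s d - persp p s (d + h)"
proof (cases "h = 0")
  case False
  have "\<exists>z. d < z \<and> z < d + h \<and>
      (d + h) powr (1 - p) - d powr (1 - p) = (d + h - d) * ((1 - p) * z powr (1 - p - 1))"
    by (rule MVT2) (use False assms in \<open>auto intro!: derivative_eq_intros\<close>)
  then obtain z where z: "d < z" "z < d + h"
    "d powr (1 - p) - (d + h) powr (1 - p) = (p - 1) * h * z powr - p"
    by (auto simp: algebra_simps)
  have "(p - 1) * h * (d + h) powr - p \<le> (p - 1) * h * z powr - p"
    using assms z by (intro mult_left_mono powr_mono2') auto
  thus ?thesis
    unfolding persp_def right_diff_distrib[symmetric] using z(3)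
    by (intro mult_left_mono) auto
qed simp

text \<open>Splitting \<open>S\<close> over the node and its two children by subadditivity leaves
  the denominator \<open>l + D0 + D1\<close>. Raising it by \<open>w / (p - 1)\<close> to
  \<open>D\<close> gains at least \<open>S powr p * w * D powr - p\<close>, the factor
  \<open>p - 1\<close> from the derivative cancelling. The bound on \<open>D\<close> then replaces
  \<open>D\<close> by \<open>m\<close> at the price of \<open>(p / (p - 1)) powr p\<close>.\<close>

lemma persp_node_step:
  assumes p: "1 < p" and pos: "0 < S0" "0 < S1" "0 < D0" "0 < D1" "0 < f" "0 < l" "0 < m"
    and w: "0 \<le> w" and D: "D = l + D0 + D1 + w / (p - 1)" "D \<le> p / (p - 1) * m"
    and S: "S = f * l + S0 + S1"
  shows "w * (S / m) powr p \<le> (p / (p - 1)) powr p *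
    (f powr p * l + persp p S0 D0 + persp p S1 D1 - persp p S D)"
proof -
  define h where "h = w / (p - 1)"
  have h: "0 \<le> h" "(p - 1) * h = w"
    using p w by (auto simp: h_def)
  have S_pos: "0 < S" and D_pos: "0 < D"
    using pos h(1) unfolding S D h_def[symmetric] by (auto intro!: add_pos_pos add_pos_nonneg)
  have "persp p S (l + D0 + D1) \<le> persp p (f * l + S0) (l + D0) + persp p S1 D1"
    unfolding S by (rule persp_subadditive) (use p pos in \<open>auto intro: add_pos_pos\<close>)
  also have "persp p (f * l + S0) (l + D0) \<le> persp p (f * l) l + persp p S0 D0"
    by (rule persp_subadditive) (use p pos in auto)
  also have "persp p (f * l) l = f powr p * l"
    using pos by (simp add: persp_eq)
  finally have "S powr p * (w * D powr - p)
      \<le> f powr p * l + persp p S0 D0 + persp p S1 D1 - persp p S D"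
    using persp_decrease[OF p _ h(1), of "l + D0 + D1" S] pos h(2)
    unfolding D(1) h_def by simp
  moreover have "w * (S / m) powr p \<le> (p / (p - 1)) powr p * (S powr p * (w * D powr - p))"
  proof -
    have "(p / (p - 1) * m) powr - p \<le> D powr - p"
      using p D_pos D(2) by (intro powr_mono2') auto
    moreover have "(p / (p - 1) * m) powr - p = inverse ((p / (p - 1)) powr p) * m powr - p"
      using p pos by (simp only: powr_mult powr_minus inverse_mult_distrib)
    moreover have "0 < (p / (p - 1)) powr p"
      using p by simp
    ultimately have "m powr - p \<le> (p / (p - 1)) powr p * D powr - p"
      by (simp add: field_simps)
    hence "w * S powr p * m powr - p \<le> w * S powr p * ((p / (p - 1)) powr p * D powr - p)"
      using w by (intro mult_left_mono) auto
    thus ?thesis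
      using pos S_pos by (simp add: powr_divide powr_minus field_simps)
  qed
  ultimately show ?thesis
    by (meson mult_left_mono order_trans powr_ge_zero)
qed

text \<open>A Bellman function argument: the right-hand side is superadditive along the tree, with a
  gain at each node that pays for the corresponding term of the left-hand side.\<close>

lemma depth_sum_carleson_le:
  fixes l f w mu M S F :: "bool list \<Rightarrow> real"
  assumes p: "1 < p"
    and pos: "\<And>v. 0 < l v" "\<And>v. 0 < f v" "\<And>v. 0 \<le> w v" "\<And>v. 0 < mu v" "\<And>v. 0 < S v" "\<And>v. 0 \<le> M v"
    and mu: "\<And>v. mu v = l v + mu (v @ [False]) + mu (v @ [True])"
    and M: "\<And>v. M v = w v + M (v @ [False]) + M (v @ [True])"
    and S: "\<And>v. S v = f v * l v + S (v @ [False]) + S (v @ [True])"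
    and F: "\<And>v. F v = f v powr p * l v + F (v @ [False]) + F (v @ [True])"
    and carleson: "\<And>v. M v \<le> mu v"
    and holder: "\<And>v. persp p (S v) (mu v) \<le> F v"
  shows "depth_sum n (\<lambda>v. w v * (S v / mu v) powr p) v
    \<le> (p / (p - 1)) powr p * (F v - persp p (S v) (mu v + M v / (p - 1)))"
proof (induction n arbitrary: v)
  case 0
  \<comment> \<open>The empty truncation asks for nonnegativity of the right-hand side: enlarging
    the denominator beyond \<open>mu v\<close> only lowers the term that \<open>holder\<close>
    bounds by \<open>F v\<close>.\<close>
  have "persp p (S v) (mu v + M v / (p - 1)) \<le> persp p (S v) (mu v)"
    using p pos by (intro persp_antimono) auto
  thus ?case
    using holder[of v] by simp
next
  case (Suc n)
  let ?D = "\<lambda>v. mu v + M v / (p - 1)"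
  let ?C = "(p / (p - 1)) powr p"
  let ?a = "v @ [False]" and ?b = "v @ [True]"
  have D_pos: "0 < ?D u" for u
    using p pos[of u] by (intro add_pos_nonneg) auto
  have "?D v = l v + ?D ?a + ?D ?b + w v / (p - 1)"
    by (subst mu, subst M) (simp add: add_divide_distrib)
  \<comment> \<open>The origin of the sharp constant: \<open>M v \<le> mu v\<close> bounds
    \<open>?D v\<close> by \<open>1 + 1 / (p - 1) = p / (p - 1)\<close> times
    \<open>mu v\<close>.\<close>
  moreover have "?D v \<le> p / (p - 1) * mu v"
  proof -
    have "?D v \<le> mu v + mu v / (p - 1)"
      using carleson[of v] p by (simp add: divide_right_mono)
    also have "\<dots> = p / (p - 1) * mu v"
      using p by (simp add: field_simps)
    finally show ?thesis .
  qed
  ultimately have "w v * (S v / mu v) powr p \<le> ?C *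
      (f v powr p * l v + persp p (S ?a) (?D ?a) + persp p (S ?b) (?D ?b) - persp p (S v) (?D v))"
    using p pos D_pos S[of v] by (intro persp_node_step) auto
  hence "depth_sum (Suc n) (\<lambda>v. w v * (S v / mu v) powr p) v \<le>
      ?C * (f v powr p * l v + persp p (S ?a) (?D ?a) + persp p (S ?b) (?D ?b) - persp p (S v) (?D v))
      + ?C * (F ?a - persp p (S ?a) (?D ?a)) + ?C * (F ?b - persp p (S ?b) (?D ?b))"
    using Suc[of ?a] Suc[of ?b] by simp
  also have "\<dots> = ?C * (F v - persp p (S v) (?D v))"
    by (subst F[of v]) (simp add: algebra_simps)
  finally show ?case .
qed

section \<open>Hoelder's inequality on truncated trees\<close>

lemma depth_sum_pos:
  fixes g :: "bool list \<Rightarrow> real"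
  assumes "\<And>v. 0 < g v"
  shows "0 < depth_sum (Suc n) g v"
  using assms[of v] depth_sum_nonneg[of g n] assms
  by (auto intro!: add_pos_nonneg simp: less_imp_le)

text \<open>This is Hoelder's inequality for the measure \<open>l\<close>: the power of the sum of
  \<open>f * l\<close> is at most the sum of \<open>f powr p * l\<close> times the power
  \<open>p - 1\<close> of the total mass. It follows by adding nodes one at a time with
  subadditivity. The depth \<open>Suc n\<close> keeps all arguments of \<open>persp\<close>
  positive.\<close>

lemma persp_depth_sum_le:
  fixes f l :: "bool list \<Rightarrow> real"
  assumes "1 \<le> p" "\<And>v. 0 < f v" "\<And>v. 0 < l v"
  shows "persp p (depth_sum (Suc n) (\<lambda>v. f v * l v) v) (depth_sum (Suc n) l v)
    \<le> depth_sum (Suc n) (\<lambda>v. f v powr p * l v) v"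
proof (induction n arbitrary: v)
  case 0
  show ?case
    using assms(2,3)[of v] by (simp add: persp_eq)
next
  case (Suc n)
  let ?a = "v @ [False]" and ?b = "v @ [True]"
  let ?S = "\<lambda>v. depth_sum (Suc n) (\<lambda>v. f v * l v) v" and ?m = "\<lambda>v. depth_sum (Suc n) l v"
  have pos: "0 < ?S u" "0 < ?m u" "0 < f u * l u" for u
    using assms by (auto intro!: depth_sum_pos simp del: depth_sum.simps)
  have "persp p (f v * l v + ?S ?a + ?S ?b) (l v + ?m ?a + ?m ?b)
      \<le> persp p (f v * l v + ?S ?a) (l v + ?m ?a) + persp p (?S ?b) (?m ?b)"
    by (rule persp_subadditive)
      (use assms pos in \<open>auto intro: add_pos_pos simp del: depth_sum.simps\<close>)
  also have "persp p (f v * l v + ?S ?a) (l v + ?m ?a)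
      \<le> persp p (f v * l v) (l v) + persp p (?S ?a) (?m ?a)"
    by (rule persp_subadditive) (use assms pos in \<open>auto simp del: depth_sum.simps\<close>)
  also have "persp p (f v * l v) (l v) = f v powr p * l v"
    using assms(2,3)[of v] by (simp add: persp_eq)
  finally show ?case
    using Suc[of ?a] Suc[of ?b] by (subst (1 2 3) depth_sum.simps(2)) linarith
qed

text \<open>\<open>enn2real\<close> sends infinity to 0, so this is used only when the sum over the
  whole tree is finite, which bounds all subtree sums.\<close>

definition real_sum :: "(bool list \<Rightarrow> real) \<Rightarrow> bool list \<Rightarrow> real" where
  "real_sum g v = enn2real (subtree_sum (\<lambda>v. ennreal (g v)) v)"

lemma real_sum_nonneg: "0 \<le> real_sum g v"
  by (simp add: real_sum_def)

lemma ennreal_real_sum: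
  assumes "subtree_sum (\<lambda>v. ennreal (g v)) [] < \<infinity>"
  shows "subtree_sum (\<lambda>v. ennreal (g v)) v = ennreal (real_sum g v)"
  using assms subtree_sum_le_root[of "\<lambda>v. ennreal (g v)" v]
  by (simp add: real_sum_def le_less_trans)

lemma real_sum_rec:
  assumes fin: "subtree_sum (\<lambda>v. ennreal (g v)) [] < \<infinity>" and nonneg: "\<And>v. 0 \<le> g v"
  shows "real_sum g v = g v + real_sum g (v @ [False]) + real_sum g (v @ [True])"
proof -
  have "ennreal (real_sum g v) =
      ennreal (g v) + ennreal (real_sum g (v @ [False])) + ennreal (real_sum g (v @ [True]))"
    unfolding ennreal_real_sum[OF fin, symmetric] by (rule subtree_sum_rec)
  also have "\<dots> = ennreal (g v + real_sum g (v @ [False]) + real_sum g (v @ [True]))"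
    using nonneg[of v] by (simp only: ennreal_plus real_sum_nonneg add_nonneg_nonneg)
  finally show ?thesis
    using nonneg[of v] real_sum_nonneg by (subst (asm) ennreal_inj) auto
qed

lemma depth_sum_le_real_sum:
  assumes "subtree_sum (\<lambda>v. ennreal (g v)) [] < \<infinity>" "\<And>v. 0 \<le> g v"
  shows "depth_sum n g v \<le> real_sum g v"
  using depth_sum_le_subtree_sum[of n "\<lambda>v. ennreal (g v)" v] assms(2) real_sum_nonneg
  by (simp add: ennreal_real_sum[OF assms(1)] ennreal_depth_sum[symmetric])

section \<open>Reduction of (i) to the Bellman induction\<close>

theorem tree_H_imp_tree_T:
  assumes p: "1 < p" "1 / p + 1 / p' = 1" and pos: "\<And>v. 0 < A v" "\<And>v. 0 < lam v"
    and H: "tree_H p A lam"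
  shows "tree_T p p' A lam ((p / (p - 1)) powr p)"
  unfolding tree_T_def
proof (intro allI impI)
  fix \<phi> :: "bool list \<Rightarrow> real"
  assume \<phi>: "\<forall>v. 0 < \<phi> v" and fin: "subtree_sum (\<lambda>v. ennreal (\<phi> v powr p)) [] < \<infinity>"
  define f where "f v = \<phi> v / lam v powr (1 / p)" for v
  have f_pos: "0 < f v" for v
    using \<phi> pos[of v] by (simp add: f_def)
  have f_lam: "\<phi> v * lam v powr (1 / p') = f v * lam v" for v
  proof -
    have "1 / p' = 1 - 1 / p"
      using p by simp
    hence "lam v powr (1 / p') = lam v / lam v powr (1 / p)"
      using pos[of v] by (simp only: powr_diff) simp
    thus ?thesis
      by (simp add: f_def)
  qed
  have f_powr: "\<phi> v powr p = f v powr p * lam v" for v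
    using \<phi> pos[of v] p by (simp add: f_def powr_divide powr_powr less_imp_le)
  define F where "F = real_sum (\<lambda>v. \<phi> v powr p)"
  note F = ennreal_real_sum[OF fin, folded F_def] real_sum_nonneg[of "(\<lambda>v. \<phi> v powr p)", folded F_def]
    real_sum_rec[OF fin powr_ge_zero, folded F_def] depth_sum_le_real_sum[OF fin powr_ge_zero, folded F_def]
  have lam_fin: "subtree_sum (\<lambda>v. ennreal (lam v)) [] < \<infinity>"
    using H by (auto simp: tree_H_def)
  define mu where "mu = real_sum lam"
  note mu = ennreal_real_sum[OF lam_fin, folded mu_def] real_sum_nonneg[of "lam", folded mu_def]
    real_sum_rec[OF lam_fin less_imp_le[OF pos(2)], folded mu_def] depth_sum_le_real_sum[OF lam_fin less_imp_le[OF pos(2)], folded mu_def]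
  have mu_pos: "0 < mu v" for v
    using pos(2)[of v] mu(2)[of "v @ [False]"] mu(2)[of "v @ [True]"] mu(3)[of v] by linarith
  \<comment> \<open>The Carleson weights: (H) bounds their subtree sums by \<open>mu\<close>, and
    \<open>w v * (S v / mu v) powr p\<close> is the term \<open>A v * S v powr p\<close> of
    (T).\<close>
  define w where "w v = A v * mu v powr p" for v
  have w_nonneg: "0 \<le> w v" for v
    using pos(1)[of v] by (simp add: w_def)
  have H': "subtree_sum (\<lambda>v. ennreal (w v)) v \<le> ennreal (mu v)" for v
    using H pos mu(1,2) unfolding tree_H_def w_def
    by (simp add: ennpowr_ennreal ennreal_mult less_imp_le)
  have w_fin: "subtree_sum (\<lambda>v. ennreal (w v)) [] < \<infinity>"
    using le_less_trans[OF H'[of "[]"]] by simp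
  define M where "M = real_sum w"
  note M = ennreal_real_sum[OF w_fin, folded M_def] real_sum_nonneg[of "w", folded M_def]
    real_sum_rec[OF w_fin w_nonneg, folded M_def] depth_sum_le_real_sum[OF w_fin w_nonneg, folded M_def]
  have M_le: "M v \<le> mu v" for v
    using H'[of v] M(1,2) mu(2) by simp
  \<comment> \<open>Hoelder's bound for the subtree sum of \<open>f * lam\<close>. It is proved on
    truncations first, since it is what makes that sum finite and the real-valued \<open>S\<close>
    below meaningful.\<close>
  define B where "B v = (F v * mu v powr (p - 1)) powr (1 / p)" for v
  have B: "depth_sum n (\<lambda>v. f v * lam v) v \<le> B v" for n v
  proof -
    let ?s = "depth_sum (Suc n) (\<lambda>v. f v * lam v) v"
    let ?m = "depth_sum (Suc n) lam v"
    have s: "0 < ?s" and m: "0 < ?m"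
      using f_pos pos by (auto intro!: depth_sum_pos simp del: depth_sum.simps)
    have "persp p ?s (mu v) \<le> persp p ?s ?m"
      using p m mu(4) by (intro persp_antimono) (auto simp del: depth_sum.simps)
    also have "\<dots> \<le> depth_sum (Suc n) (\<lambda>v. f v powr p * lam v) v"
      using p f_pos pos by (intro persp_depth_sum_le) auto
    also have "\<dots> \<le> F v"
      using F(4) by (simp add: f_powr del: depth_sum.simps)
    finally have "?s powr p \<le> F v * mu v powr (p - 1)"
      using mu_pos[of v] by (simp add: persp_def powr_diff field_simps del: depth_sum.simps)
    hence "(?s powr p) powr (1 / p) \<le> B v"
      unfolding B_def using p by (intro powr_mono2) auto
    hence "?s \<le> B v"
      using p s by (simp add: powr_powr del: depth_sum.simps)
    moreover have "depth_sum n (\<lambda>v. f v * lam v) v \<le> ?s"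
      using f_pos pos by (intro depth_sum_mono_depth) (auto simp: less_imp_le)
    ultimately show ?thesis by linarith
  qed
  have S_le_B: "subtree_sum (\<lambda>v. ennreal (f v * lam v)) v \<le> ennreal (B v)" for v
    using B f_pos pos
    by (intro subtree_sum_leI) (simp add: ennreal_depth_sum[symmetric] less_imp_le ennreal_leI)
  have fl_nonneg: "0 \<le> f v * lam v" for v
    using f_pos[of v] pos(2)[of v] by simp
  have fl_fin: "subtree_sum (\<lambda>v. ennreal (f v * lam v)) [] < \<infinity>"
    using le_less_trans[OF S_le_B[of "[]"]] by simp
  define S where "S = real_sum (\<lambda>v. f v * lam v)"
  note S = ennreal_real_sum[OF fl_fin, folded S_def] real_sum_nonneg[of "(\<lambda>v. f v * lam v)", folded S_def]
    real_sum_rec[OF fl_fin fl_nonneg, folded S_def] depth_sum_le_real_sum[OF fl_fin fl_nonneg, folded S_def]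
  have S_pos: "0 < S v" for v
  proof -
    have "0 < f v * lam v"
      using f_pos pos by simp
    thus ?thesis
      using S(2)[of "v @ [False]"] S(2)[of "v @ [True]"] S(3)[of v] by linarith
  qed
  have holder: "persp p (S v) (mu v) \<le> F v" for v
  proof -
    have "S v \<le> B v"
      using S_le_B[of v] S(1) S(2)[of v] by (simp add: B_def)
    hence "S v powr p \<le> B v powr p"
      using S(2) p by (intro powr_mono2) auto
    also have "\<dots> = F v * mu v powr (p - 1)"
      using p F(2) by (simp add: B_def powr_powr)
    finally show ?thesis
      using mu_pos[of v] by (simp add: persp_def powr_diff field_simps)
  qed
  let ?C = "(p / (p - 1)) powr p"
  have "depth_sum n (\<lambda>v. w v * (S v / mu v) powr p) [] \<le> ?C * F []" for n
  proof -
    have "depth_sum n (\<lambda>v. w v * (S v / mu v) powr p) []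
        \<le> ?C * (F [] - persp p (S []) (mu [] + M [] / (p - 1)))"
      by (rule depth_sum_carleson_le[OF p(1) pos(2) f_pos w_nonneg mu_pos S_pos M(2) mu(3) M(3)
            S(3) F(3)[unfolded f_powr] M_le holder])
    also have "\<dots> \<le> ?C * F []"
      by (intro mult_left_mono) (simp_all add: persp_def)
    finally show ?thesis .
  qed
  moreover have "w v * (S v / mu v) powr p = A v * S v powr p" for v
    using mu_pos[of v] S_pos[of v] by (simp add: w_def powr_divide)
  ultimately have "depth_sum n (\<lambda>v. A v * S v powr p) [] \<le> ?C * F []" for n
    by simp
  hence "subtree_sum (\<lambda>v. ennreal (A v * S v powr p)) [] \<le> ennreal (?C * F [])"
    using pos(1) by (intro subtree_sum_leI)
      (simp add: ennreal_depth_sum[symmetric] less_imp_le ennreal_leI)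
  thus "subtree_sum (\<lambda>v. ennreal (A v) *
          ennpowr (subtree_sum (\<lambda>w. ennreal (\<phi> w * lam w powr (1 / p'))) v) p) []
        \<le> ennreal ?C * subtree_sum (\<lambda>v. ennreal (\<phi> v powr p)) []"
    using pos(1) S(1,2) F(1,2)
    by (simp add: f_lam ennpowr_ennreal ennreal_mult less_imp_le)
qed

section \<open>The converse\<close>

text \<open>A positive weight with total mass 1, as level \<open>n\<close> has \<open>2 ^ n\<close>
  words. It perturbs test functions to positive ones and later spreads a small mass over the
  subtrees off the leftmost branch.\<close>

definition quarter :: "bool list \<Rightarrow> real" where
  "quarter v = (1 / 2) * (1 / 4) ^ length v"

lemma quarter_pos: "0 < quarter v"
  by (simp add: quarter_def)

text \<open>The recursion reproduces the bound: the node takes half of it and each child a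
  quarter.\<close>

lemma depth_sum_quarter_le: "depth_sum n quarter v \<le> (1 / 4) ^ length v"
proof (induction n arbitrary: v)
  case (Suc n)
  show ?case
    using Suc[of "v @ [False]"] Suc[of "v @ [True]"] by (simp add: quarter_def)
qed simp

lemma subtree_sum_quarter_le: "subtree_sum (\<lambda>v. ennreal (quarter v)) [] \<le> 1"
proof (rule subtree_sum_leI)
  fix n
  have "ennreal (depth_sum n quarter []) \<le> ennreal 1"
    using depth_sum_quarter_le[of n "[]"] by (intro ennreal_leI) simp
  thus "depth_sum n (\<lambda>v. ennreal (quarter v)) [] \<le> 1"
    by (simp add: ennreal_depth_sum quarter_pos less_imp_le)
qed

text \<open>(T) speaks of positive functions only, while cut-off test functions vanish on part of
  the tree. Adding \<open>d * quarter\<close> to \<open>f powr p\<close> makes the function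
  positive, does not lower the left side, and costs at most \<open>C * d = e\<close> on the
  right.\<close>

lemma tree_T_nonneg:
  fixes f :: "bool list \<Rightarrow> real"
  assumes T: "tree_T p p' A lam C" and "0 < p" "0 < C"
    and f: "\<And>v. 0 \<le> f v" and fin: "subtree_sum (\<lambda>v. ennreal (f v powr p)) [] < \<infinity>"
  shows "subtree_sum (\<lambda>v. ennreal (A v) *
          ennpowr (subtree_sum (\<lambda>w. ennreal (f w * lam w powr (1 / p'))) v) p) []
        \<le> ennreal C * subtree_sum (\<lambda>v. ennreal (f v powr p)) []" (is "?L \<le> _ * ?F")
proof (rule ennreal_le_epsilon)
  fix e :: real assume e: "0 < e"
  define d where "d = e / C"
  have d: "0 < d" "C * d = e"
    using e assms by (auto simp: d_def)
  define \<phi> where "\<phi> v = (f v powr p + d * quarter v) powr (1 / p)" for v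
  have dq: "0 < d * quarter v" for v
    using d(1) quarter_pos by simp
  have sum_pos: "0 < f v powr p + d * quarter v" for v
    using dq[of v] by (intro add_nonneg_pos) auto
  have \<phi>_pos: "0 < \<phi> v" for v
    using sum_pos[of v] by (simp add: \<phi>_def)
  have \<phi>_powr: "\<phi> v powr p = f v powr p + d * quarter v" for v
    using sum_pos[of v] assms(2) by (simp add: \<phi>_def powr_powr)
  have f_le: "f v \<le> \<phi> v" for v
  proof -
    have "(f v powr p) powr (1 / p) \<le> \<phi> v"
      unfolding \<phi>_def using dq[of v] assms(2) by (intro powr_mono2) auto
    thus ?thesis
      using f[of v] assms(2) by (simp add: powr_powr)
  qed
  have "subtree_sum (\<lambda>v. ennreal (\<phi> v powr p)) []
      = subtree_sum (\<lambda>v. ennreal (f v powr p) + ennreal d * ennreal (quarter v)) []"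
    using d(1) by (simp add: \<phi>_powr ennreal_plus ennreal_mult quarter_pos less_imp_le)
  also have "\<dots> = ?F + ennreal d * subtree_sum (\<lambda>v. ennreal (quarter v)) []"
    by (simp add: subtree_sum_add subtree_sum_cmult)
  also have "\<dots> \<le> ?F + ennreal d * 1"
    by (intro add_left_mono mult_left_mono subtree_sum_quarter_le) simp
  finally have \<phi>_sum: "subtree_sum (\<lambda>v. ennreal (\<phi> v powr p)) [] \<le> ?F + ennreal d"
    by simp
  hence "subtree_sum (\<lambda>v. ennreal (\<phi> v powr p)) [] < \<infinity>"
    using fin by (simp add: le_less_trans)
  hence "subtree_sum (\<lambda>v. ennreal (A v) *
          ennpowr (subtree_sum (\<lambda>w. ennreal (\<phi> w * lam w powr (1 / p'))) v) p) []
        \<le> ennreal C * subtree_sum (\<lambda>v. ennreal (\<phi> v powr p)) []"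
    using T \<phi>_pos unfolding tree_T_def by blast
  also have "\<dots> \<le> ennreal C * (?F + ennreal d)"
    by (intro mult_left_mono \<phi>_sum) simp
  also have "\<dots> = ennreal C * ?F + ennreal e"
    using d assms(3) by (simp add: distrib_left ennreal_mult[symmetric])
  finally have "subtree_sum (\<lambda>v. ennreal (A v) *
          ennpowr (subtree_sum (\<lambda>w. ennreal (\<phi> w * lam w powr (1 / p'))) v) p) []
        \<le> ennreal C * ?F + ennreal e" .
  moreover have "?L \<le> subtree_sum (\<lambda>v. ennreal (A v) *
          ennpowr (subtree_sum (\<lambda>w. ennreal (\<phi> w * lam w powr (1 / p'))) v) p) []"
    using f_le assms(2)
    by (intro subtree_sum_mono mult_left_mono ennpowr_mono ennreal_leI mult_right_mono) auto
  ultimately show "?L \<le> ennreal C * ?F + ennreal e"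
    by (rule order_trans[rotated])
qed

text \<open>The test function is \<open>lam powr (1 / p)\<close> on the first \<open>n\<close>
  levels below \<open>u\<close> and 0 elsewhere, so that \<open>f powr p\<close> and
  \<open>f * lam powr (1 / p')\<close> both equal \<open>lam\<close> there. The cut-off gives it a
  finite norm before \<open>lam\<close> is known to be summable.\<close>

lemma tree_T_truncated:
  assumes p: "1 < p" "1 / p + 1 / p' = 1" and pos: "\<And>v. 0 < A v" "\<And>v. 0 < lam v"
    and T: "tree_T p p' A lam 1"
  shows "(\<Sum>w | length w < m. A (u @ w) * depth_sum (n - length w) lam (u @ w) powr p)
    \<le> depth_sum n lam u"
proof -
  define G where "G = (@) u ` {w. length w < n}"
  define g where "g v = (if v \<in> G then lam v else 0)" for v
  define f where "f v = g v powr (1 / p)" for v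
  have g_nonneg: "0 \<le> g v" for v
    using pos(2)[of v] by (simp add: g_def)
  have lam_nonneg: "0 \<le> lam v" for v
    using pos(2)[of v] by simp
  have f_powr: "f v powr p = g v" for v
    using p g_nonneg[of v] by (simp add: f_def powr_powr)
  have f_lam: "f v * lam v powr (1 / p') = g v" for v
    using p(2) pos(2)[of v] by (simp add: f_def g_def powr_add[symmetric])
  have "subtree_sum (\<lambda>v. ennreal (g v)) [] = (\<Sum>\<^sub>\<infinity>v\<in>G. ennreal (lam v))"
    unfolding subtree_sum_def by (rule infsum_cong_neutral) (auto simp: g_def)
  also have "\<dots> = (\<Sum>v\<in>G. ennreal (lam v))"
    by (simp add: infsum_finite G_def finite_lists_shorter)
  also have "\<dots> = (\<Sum>w | length w < n. ennreal (lam (u @ w)))"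
    unfolding G_def by (subst sum.reindex) (auto simp: inj_on_def)
  also have "\<dots> = ennreal (depth_sum n lam u)"
    using lam_nonneg by (simp add: depth_sum_eq_sum)
  finally have g_sum: "subtree_sum (\<lambda>v. ennreal (g v)) [] = ennreal (depth_sum n lam u)" .
  have T': "subtree_sum (\<lambda>v. ennreal (A v) * ennpowr (subtree_sum (\<lambda>w. ennreal (g w)) v) p) []
      \<le> ennreal (depth_sum n lam u)" (is "subtree_sum ?h [] \<le> _")
    using tree_T_nonneg[OF T, of f] p(1) by (simp add: f_powr f_lam g_sum f_def[symmetric]) (simp add: f_def)
  have h: "ennreal (A (u @ w) * depth_sum (n - length w) lam (u @ w) powr p) \<le> ?h (u @ w)" for w
  proof -
    \<comment> \<open>At depth \<open>length w\<close> below \<open>u\<close>, only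
      \<open>n - length w\<close> levels of the test function remain. From depth \<open>n\<close>
      on, the difference of natural numbers is 0 and both sums are empty.\<close>
    have "depth_sum (n - length w) lam (u @ w) = depth_sum (n - length w) g (u @ w)"
      unfolding depth_sum_eq_sum by (rule sum.cong) (auto simp: g_def G_def)
    hence "ennreal (depth_sum (n - length w) lam (u @ w)) \<le> subtree_sum (\<lambda>w. ennreal (g w)) (u @ w)"
      using depth_sum_le_subtree_sum g_nonneg by (simp add: ennreal_depth_sum)
    hence "ennpowr (ennreal (depth_sum (n - length w) lam (u @ w))) p
        \<le> ennpowr (subtree_sum (\<lambda>w. ennreal (g w)) (u @ w)) p"
      using p by (intro ennpowr_mono) auto
    hence "ennreal (depth_sum (n - length w) lam (u @ w) powr p)
        \<le> ennpowr (subtree_sum (\<lambda>w. ennreal (g w)) (u @ w)) p"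
      using lam_nonneg by (simp add: ennpowr_ennreal depth_sum_nonneg)
    thus ?thesis
      using pos(1)[of "u @ w"] by (simp add: ennreal_mult mult_left_mono)
  qed
  have term_nonneg: "0 \<le> A (u @ w) * depth_sum (n - length w) lam (u @ w) powr p" for w
    using pos(1)[of "u @ w"] by simp
  have "ennreal (\<Sum>w | length w < m. A (u @ w) * depth_sum (n - length w) lam (u @ w) powr p)
      = (\<Sum>w | length w < m. ennreal (A (u @ w) * depth_sum (n - length w) lam (u @ w) powr p))"
    using term_nonneg by (subst sum_ennreal) auto
  also have "\<dots> \<le> (\<Sum>w | length w < m. ?h (u @ w))"
    by (intro sum_mono h)
  also have "\<dots> = depth_sum m ?h u"
    by (simp add: depth_sum_eq_sum)
  also have "\<dots> \<le> subtree_sum ?h u"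
    by (rule depth_sum_le_subtree_sum)
  also have "\<dots> \<le> subtree_sum ?h []"
    by (rule subtree_sum_le_root)
  also note T'
  finally show ?thesis
    using lam_nonneg by (subst (asm) ennreal_le_iff) (auto simp: depth_sum_nonneg)
qed

theorem tree_T_imp_tree_H:
  assumes p: "1 < p" "1 / p + 1 / p' = 1" and pos: "\<And>v. 0 < A v" "\<And>v. 0 < lam v"
    and T: "tree_T p p' A lam 1"
  shows "tree_H p A lam"
proof -
  note trunc = tree_T_truncated[OF p pos T]
  have lam_nonneg: "0 \<le> lam v" for v
    using pos(2)[of v] by simp
  \<comment> \<open>The root term alone gives \<open>A [] * D powr p \<le> D\<close> for every
    truncation \<open>D\<close> of the total mass. Solving for \<open>D\<close> yields this bound,
    which does not depend on the depth.\<close>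
  define B where "B = (1 / A []) powr (1 / (p - 1))"
  have "depth_sum n lam [] \<le> B" for n
  proof (cases n)
    case 0
    thus ?thesis by (simp add: B_def)
  next
    case (Suc k)
    define D where "D = depth_sum n lam []"
    have D: "0 < D"
      unfolding D_def Suc by (rule depth_sum_pos[OF pos(2)])
    have "{w :: bool list. length w < 1} = {[]}" by auto
    hence "A [] * D powr p \<le> D"
      using trunc[where m = 1 and u = "[]" and n = n] by (simp add: D_def)
    hence "D powr (p - 1) \<le> 1 / A []"
      using D pos(1)[of "[]"] by (simp add: powr_diff field_simps)
    hence "(D powr (p - 1)) powr (1 / (p - 1)) \<le> B"
      unfolding B_def using p by (intro powr_mono2) auto
    thus ?thesis
      using D p by (simp add: powr_powr D_def)
  qed
  hence "subtree_sum (\<lambda>v. ennreal (lam v)) [] \<le> ennreal B"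
    using lam_nonneg by (intro subtree_sum_leI) (simp add: ennreal_depth_sum[symmetric] ennreal_leI)
  hence fin: "subtree_sum (\<lambda>v. ennreal (lam v)) [] < \<infinity>"
    by (rule le_less_trans) simp
  define mu where "mu = real_sum lam"
  note mu = ennreal_real_sum[OF fin, folded mu_def] real_sum_nonneg[of lam, folded mu_def]
  have lim: "(\<lambda>n. depth_sum n lam v) \<longlonglongrightarrow> mu v" for v
  proof -
    have "(\<lambda>n. ennreal (depth_sum n lam v)) \<longlonglongrightarrow> ennreal (mu v)"
      using depth_sum_tendsto[of "\<lambda>v. ennreal (lam v)" v] lam_nonneg
      by (simp add: mu(1) ennreal_depth_sum)
    thus ?thesis
      by (rule tendsto_ennrealD) (auto simp: mu(2) depth_sum_nonneg lam_nonneg)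
  qed
  \<comment> \<open>With \<open>m\<close> fixed, \<open>n\<close> tends to infinity in the truncated
    inequality: the sum over \<open>w\<close> stays finite and the inner truncations tend to
    \<open>mu\<close>.\<close>
  have H: "depth_sum m (\<lambda>v. A v * mu v powr p) u \<le> mu u" for m u
    unfolding depth_sum_eq_sum
  proof (rule LIMSEQ_le[OF _ lim])
    have "(\<lambda>n. depth_sum (n - length w) lam (u @ w)) \<longlonglongrightarrow> mu (u @ w)" for w
      by (rule filterlim_compose[OF lim filterlim_minus_const_nat_at_top])
    thus "(\<lambda>n. \<Sum>w | length w < m. A (u @ w) * depth_sum (n - length w) lam (u @ w) powr p)
        \<longlonglongrightarrow> (\<Sum>w | length w < m. A (u @ w) * mu (u @ w) powr p)"
      using p by (intro tendsto_sum tendsto_mult tendsto_const tendsto_powr')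
        (auto simp: depth_sum_nonneg lam_nonneg)
  qed (use trunc in blast)
  have "subtree_sum (\<lambda>v. ennreal (A v * mu v powr p)) u \<le> ennreal (mu u)" for u
    using H pos(1) by (intro subtree_sum_leI)
      (simp add: ennreal_depth_sum[symmetric] less_imp_le ennreal_leI)
  thus ?thesis
    using pos(1) unfolding tree_H_def
    by (simp add: mu ennpowr_ennreal ennreal_mult less_imp_le)
qed

section \<open>Sharpness\<close>

lemma subtree_sum_Cons_scale:
  assumes "\<And>w. g (b # w) = c * h w"
  shows "subtree_sum g (b # v) = c * subtree_sum h v"
  using assms by (simp add: subtree_sum_def subtree_sum_cmult[of c h v, unfolded subtree_sum_def])

text \<open>The left subtree is a copy of the whole tree scaled by \<open>\<rho>\<close>. The bound
  \<open>h / (1 - \<rho>)\<close> is the fixed point of \<open>x \<mapsto> h + \<rho> * x\<close>,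
  hence preserved by the induction on the depth.\<close>

lemma subtree_sum_geometric_le:
  assumes g: "\<And>v. g (False # v) = ennreal \<rho> * g v" and \<rho>: "0 \<le> \<rho>" "\<rho> < 1" and "0 \<le> h"
    and le: "g [] + subtree_sum g [True] \<le> ennreal h"
  shows "subtree_sum g [] \<le> ennreal (h / (1 - \<rho>))"
proof (rule subtree_sum_leI)
  fix n show "depth_sum n g [] \<le> ennreal (h / (1 - \<rho>))"
  proof (induction n)
    case (Suc n)
    have "depth_sum n g [False] = ennreal \<rho> * depth_sum n g []"
      by (simp add: depth_sum_eq_sum g sum_distrib_left)
    also have "\<dots> \<le> ennreal \<rho> * ennreal (h / (1 - \<rho>))"
      by (intro mult_left_mono Suc) simp
    finally have "depth_sum (Suc n) g [] \<le>
        g [] + ennreal \<rho> * ennreal (h / (1 - \<rho>)) + subtree_sum g [True]"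
      unfolding depth_sum.simps append_Nil
      by (intro add_mono order_refl depth_sum_le_subtree_sum)
    also have "\<dots> = (g [] + subtree_sum g [True]) + ennreal \<rho> * ennreal (h / (1 - \<rho>))"
      by (simp only: ac_simps)
    also have "\<dots> \<le> ennreal h + ennreal \<rho> * ennreal (h / (1 - \<rho>))"
      by (intro add_right_mono le)
    also have "\<dots> = ennreal (h + \<rho> * (h / (1 - \<rho>)))"
      using assms by (simp only: ennreal_plus ennreal_mult mult_nonneg_nonneg divide_nonneg_nonneg
          diff_ge_0_iff_ge less_imp_le)
    also have "h + \<rho> * (h / (1 - \<rho>)) = h / (1 - \<rho>)"
      using \<rho> by (simp add: field_simps)
    finally show ?case .
  qed simp
qed

text \<open>Dropping the right subtree, the total is at least \<open>h\<close> plus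
  \<open>\<rho>\<close> times itself. A finite total can be solved for, and an infinite one exceeds
  every bound.\<close>

lemma subtree_sum_geometric_ge:
  assumes g: "\<And>v. g (False # v) = ennreal \<rho> * g v" and \<rho>: "0 \<le> \<rho>" "\<rho> < 1" and "0 \<le> h"
    and ge: "ennreal h \<le> g []"
  shows "ennreal (h / (1 - \<rho>)) \<le> subtree_sum g []"
proof (cases "subtree_sum g []")
  case (real s)
  have "ennreal h + ennreal \<rho> * subtree_sum g [] \<le> subtree_sum g []"
    using subtree_sum_rec[of g "[]"] subtree_sum_Cons_scale[of g False "ennreal \<rho>" g "[]", OF g] ge
    by (metis add_right_mono append_Nil le_iff_add order_trans)
  hence "h + \<rho> * s \<le> s"
    using real assms by (simp add: ennreal_mult[symmetric] ennreal_plus[symmetric] del: ennreal_plus)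
  hence "h / (1 - \<rho>) \<le> s"
    using \<rho> by (simp add: field_simps)
  thus ?thesis
    using real by (simp add: ennreal_leI)
qed simp

section \<open>The near-extremal example\<close>

text \<open>Along the leftmost branch the masses are geometric and \<open>f\<close> is a power of the remaining
  mass, which imitates the near-extremizers \<open>x powr - a\<close>, \<open>a\<close> close to \<open>1 / p\<close>, of Hardy's
  inequality on \<open>(0, 1)\<close>. The rest of the tree only carries the fraction \<open>e\<close> of the mass.\<close>

fun branch_mass :: "real \<Rightarrow> real \<Rightarrow> bool list \<Rightarrow> real" where
  "branch_mass r e [] = (1 - e) * (1 - r)"
| "branch_mass r e (b # v) = (if b then e * (1 - r) * quarter v else r * branch_mass r e v)"

fun branch_power :: "real \<Rightarrow> real \<Rightarrow> bool list \<Rightarrow> real" where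
  "branch_power r a [] = 1"
| "branch_power r a (b # v) = (if b then 1 else r powr - a * branch_power r a v)"

lemma branch_mass_pos: "0 < r \<Longrightarrow> r < 1 \<Longrightarrow> 0 < e \<Longrightarrow> e < 1 \<Longrightarrow> 0 < branch_mass r e v"
  by (induction v) (auto simp: quarter_pos)

lemma branch_power_pos: "0 < r \<Longrightarrow> 0 < branch_power r a v"
  by (induction v) auto

text \<open>The root contributes \<open>(1 - e) * (1 - r)\<close> and the right subtree, where
  \<open>branch_power\<close> is 1, at most \<open>e * (1 - r)\<close>: together
  \<open>1 - r\<close>. Passing to the left subtree multiplies each term by
  \<open>r * r powr - (a * p)\<close>.\<close>

lemma branch_sum_le:
  assumes r: "0 < r" "r < 1" "0 < e" "e < 1" and "r powr (1 - a * p) < 1"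
  shows "subtree_sum (\<lambda>v. ennreal (branch_power r a v powr p * branch_mass r e v)) []
    \<le> ennreal ((1 - r) / (1 - r powr (1 - a * p)))" (is "subtree_sum ?g [] \<le> _")
proof (rule subtree_sum_geometric_le)
  show "?g (False # v) = ennreal (r powr (1 - a * p)) * ?g v" for v
  proof -
    have eq: "branch_power r a (False # v) powr p * branch_mass r e (False # v)
        = r powr (1 - a * p) * (branch_power r a v powr p * branch_mass r e v)"
      using r branch_power_pos[of r a v] powr_add[of r 1 "- (a * p)"]
      by (simp add: powr_mult powr_powr)
    show ?thesis
      by (simp only: eq ennreal_mult' powr_ge_zero)
  qed
  have "subtree_sum ?g [True] = ennreal (e * (1 - r)) * subtree_sum (\<lambda>v. ennreal (quarter v)) []"
    by (rule subtree_sum_Cons_scale) (use r in \<open>simp add: ennreal_mult quarter_pos less_imp_le\<close>)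
  also have "\<dots> \<le> ennreal (e * (1 - r)) * 1"
    by (intro mult_left_mono subtree_sum_quarter_le) simp
  finally have "?g [] + subtree_sum ?g [True] \<le> ennreal ((1 - e) * (1 - r)) + ennreal (e * (1 - r))"
    by (simp add: add_left_mono)
  also have "\<dots> = ennreal ((1 - e) * (1 - r) + e * (1 - r))"
    using r by (subst ennreal_plus) auto
  also have "(1 - e) * (1 - r) + e * (1 - r) = 1 - r"
    by (simp add: algebra_simps)
  finally show "?g [] + subtree_sum ?g [True] \<le> ennreal (1 - r)" .
qed (use assms in auto)

text \<open>Young's inequality for \<open>1 / r\<close> and 1 gives the Bernoulli bound
  \<open>(1 / r) powr b \<le> 1 + b * (1 / r - 1)\<close>, which is then multiplied by
  \<open>r powr b \<le> 1\<close>.\<close>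

lemma one_minus_powr_le:
  fixes r b :: real
  assumes "0 < r" "r < 1" "0 < b" "b \<le> 1"
  shows "1 - r powr b \<le> b * (1 - r) / r"
proof -
  have "(1 / r) powr b * 1 powr (1 - b) \<le> b * (1 / r) + (1 - b) * 1"
    by (rule Youngs_inequality_0) (use assms in auto)
  hence "1 / r powr b - 1 \<le> b * (1 - r) / r"
    using assms by (simp add: powr_divide field_simps)
  hence "r powr b * (1 / r powr b - 1) \<le> r powr b * (b * (1 - r) / r)"
    by (intro mult_left_mono) auto
  also have "\<dots> \<le> 1 * (b * (1 - r) / r)"
    using assms by (intro mult_right_mono powr_le1) auto
  finally show ?thesis
    using assms by (simp add: right_diff_distrib)
qed

text \<open>The expression will be a lower bound for the ratio of the two sides of (T) in the
  example. As \<open>1 - 1 / p = (p - 1) / p\<close>, it tends to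
  \<open>(p / (p - 1)) powr p\<close> when \<open>t\<close> decreases to 0.\<close>

lemma sharp_parameter:
  fixes p C :: real
  assumes "1 < p" "C < (p / (p - 1)) powr p"
  obtains t where "0 < t" "t < 1" "t < 1 / p"
    "C < (1 - t) * ((1 - t)\<^sup>2 / (1 - (1 / p - t))) powr p"
proof -
  have lim: "((\<lambda>t. (1 - t) * ((1 - t)\<^sup>2 / (1 - (1 / p - t))) powr p) \<longlongrightarrow>
      (1 - 0) * ((1 - 0)\<^sup>2 / (1 - (1 / p - 0))) powr p) (at_right 0)"
    using assms by (intro tendsto_intros) auto
  have "(1 - 0) * ((1 - 0)\<^sup>2 / (1 - (1 / p - 0))) powr p = (p / (p - 1)) powr p"
    using assms by (simp add: field_simps)
  hence "\<forall>\<^sub>F t in at_right 0. C < (1 - t) * ((1 - t)\<^sup>2 / (1 - (1 / p - t))) powr p"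
    using assms by (intro order_tendstoD(1)[OF lim]) simp
  moreover have "\<forall>\<^sub>F t in at_right 0. 0 < t \<and> t < min 1 (1 / p)"
    using assms eventually_at_right_real[of 0 "min 1 (1 / p)"] by simp
  ultimately have "\<forall>\<^sub>F t in at_right 0. (0 < t \<and> t < min 1 (1 / p)) \<and>
      C < (1 - t) * ((1 - t)\<^sup>2 / (1 - (1 / p - t))) powr p"
    by (rule eventually_conj[rotated])
  hence "\<exists>t. (0 < t \<and> t < min 1 (1 / p)) \<and>
      C < (1 - t) * ((1 - t)\<^sup>2 / (1 - (1 / p - t))) powr p"
    by (rule eventually_happens'[OF trivial_limit_at_right_real])
  then obtain t where "(0 < t \<and> t < min 1 (1 / p)) \<and>
      C < (1 - t) * ((1 - t)\<^sup>2 / (1 - (1 / p - t))) powr p" ..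
  thus ?thesis
    by (intro that[of t]) simp_all
qed

theorem tree_T_sharp:
  assumes p: "1 < p" "1 / p + 1 / p' = 1" and C: "0 < C" "C < (p / (p - 1)) powr p"
  obtains A lam where "\<And>v. 0 < A v" "\<And>v. 0 < lam v" "tree_H p A lam" "\<not> tree_T p p' A lam C"
proof -
  obtain t where t: "0 < t" "t < 1" "t < 1 / p"
    and C_less: "C < (1 - t) * ((1 - t)\<^sup>2 / (1 - (1 / p - t))) powr p"
    using sharp_parameter[OF p(1) C(2)] by blast
  \<comment> \<open>One parameter controls the example: \<open>r\<close> is the ratio of the masses
    along the branch, \<open>t\<close> also serves as the fraction \<open>e\<close> off the branch,
    and \<open>a\<close> stays below the critical Hardy exponent \<open>1 / p\<close> by
    \<open>t\<close>, so that \<open>1 - a * p = t * p\<close> is positive.\<close>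
  define r where "r = 1 - t"
  define a where "a = 1 / p - t"
  define lam where "lam = branch_mass r t"
  define f where "f = branch_power r a"
  have r: "0 < r" "r < 1"
    using t by (auto simp: r_def)
  have a: "0 < a" "a < 1" "0 < 1 - a * p"
  proof -
    have "1 / p < 1"
      using p by simp
    thus "0 < a" "a < 1"
      using t by (auto simp: a_def)
    have "1 - a * p = t * p"
      using p by (simp add: a_def left_diff_distrib)
    thus "0 < 1 - a * p"
      using t p by simp
  qed
  have lam_pos: "0 < lam v" for v
    using branch_mass_pos r t by (simp add: lam_def)
  have f_pos: "0 < f v" for v
    using branch_power_pos r by (simp add: f_def)
  define \<rho> where "\<rho> = r powr (1 - a * p)"
  have \<rho>: "0 \<le> \<rho>" "\<rho> < 1"
    using r a powr_less_mono2[of "1 - a * p" r 1] by (auto simp: \<rho>_def)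

  \<comment> \<open>With exponent 0 the bound on the power sum becomes a bound on the total
    mass.\<close>
  have power_zero: "branch_power r 0 v = 1" for v
    using r by (induction v) auto
  have lam_sum: "subtree_sum (\<lambda>v. ennreal (lam v)) [] \<le> 1"
    using branch_sum_le[OF r t(1,2), of 0 p] r by (simp add: power_zero lam_def)
  hence lam_fin: "subtree_sum (\<lambda>v. ennreal (lam v)) [] < \<infinity>"
    by (rule le_less_trans) simp
  define mu where "mu = real_sum lam"
  note mu = ennreal_real_sum[OF lam_fin, folded mu_def]
  have mu_pos: "0 < mu v" for v
  proof -
    have "ennreal (lam v) \<le> ennreal (mu v)"
      using le_subtree_sum[of "\<lambda>v. ennreal (lam v)" v] by (simp add: mu)
    thus ?thesis
      using lam_pos[of v] by (auto simp: ennreal_le_iff2)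
  qed
  have mu_Nil: "mu [] \<le> 1"
    using lam_sum by (simp add: mu)
  have mu_False: "mu (False # v) = r * mu v" for v
  proof -
    have "ennreal (mu (False # v)) = ennreal r * ennreal (mu v)"
      unfolding mu[symmetric]
      by (rule subtree_sum_Cons_scale) (use r in \<open>simp add: lam_def ennreal_mult'\<close>)
    thus ?thesis
      using r mu_pos by (simp add: ennreal_mult[symmetric] less_imp_le)
  qed

  \<comment> \<open>With this weight, (H) is an equality term by term.\<close>
  define A where "A v = lam v / mu v powr p" for v
  have A_pos: "0 < A v" for v
    using lam_pos mu_pos[of v] by (simp add: A_def)
  have "A v * mu v powr p = lam v" for v
    using mu_pos[of v] by (simp add: A_def)
  hence H: "tree_H p A lam"
    unfolding tree_H_def using lam_fin A_pos mu_pos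
    by (simp add: mu ennpowr_ennreal ennreal_mult[symmetric] less_imp_le)

  define S where "S = subtree_sum (\<lambda>v. ennreal (f v * lam v))"
  have fl_False: "f (False # v) * lam (False # v) = r powr (1 - a) * (f v * lam v)" for v
    using r by (simp add: f_def lam_def powr_diff powr_minus field_simps)
  have S_False: "S (False # v) = ennreal (r powr (1 - a)) * S v" for v
    unfolding S_def
    by (rule subtree_sum_Cons_scale) (simp only: fl_False ennreal_mult' powr_ge_zero)
  \<comment> \<open>The geometric lower bound for \<open>S []\<close> is
    \<open>(1 - t) * (1 - r) / (1 - r powr (1 - a))\<close>. Its denominator is at most
    \<open>(1 - a) * (1 - r) / r\<close>, and \<open>1 - t = r\<close>.\<close>
  define s0 where "s0 = r\<^sup>2 / (1 - a)"
  have S_Nil: "ennreal s0 \<le> S []"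
  proof -
    have ra: "r powr (1 - a) < 1"
      using r a powr_less_mono2[of "1 - a" r 1] by simp
    have "r * (1 - r powr (1 - a)) \<le> (1 - a) * (1 - r)"
      using one_minus_powr_le[of r "1 - a"] r a by (simp add: field_simps)
    hence "r * (r * (1 - r powr (1 - a))) \<le> r * ((1 - a) * (1 - r))"
      using r by (intro mult_left_mono) auto
    hence "r\<^sup>2 * (1 - r powr (1 - a)) / (1 - a) \<le> r * (1 - r)"
      using a by (simp add: pos_divide_le_eq power2_eq_square mult_ac)
    hence "s0 * (1 - r powr (1 - a)) \<le> (1 - t) * (1 - r)"
      by (simp add: s0_def r_def)
    hence "s0 \<le> ((1 - t) * (1 - r)) / (1 - r powr (1 - a))"
      using ra by (simp add: pos_le_divide_eq)
    moreover have "ennreal (((1 - t) * (1 - r)) / (1 - r powr (1 - a))) \<le> S []"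
      unfolding S_def
    proof (rule subtree_sum_geometric_ge)
      show "ennreal ((1 - t) * (1 - r)) \<le> ennreal (f [] * lam [])"
        by (simp add: f_def lam_def)
    qed (use r t ra in \<open>auto simp only: fl_False ennreal_mult' powr_ge_zero
        intro!: mult_nonneg_nonneg\<close>)
    ultimately show ?thesis
      using ennreal_leI order_trans by blast
  qed
  define G where "G v = ennreal (A v) * ennpowr (S v) p" for v
  \<comment> \<open>One step to the left multiplies \<open>A\<close> by
    \<open>r powr (1 - p)\<close> and \<open>S\<close> by \<open>r powr (1 - a)\<close>, hence
    \<open>G\<close> by \<open>r powr (1 - a * p)\<close>. This is also the ratio for
    \<open>f powr p * lam\<close>, so \<open>1 - \<rho>\<close> will cancel when the two sides of
    (T) are compared.\<close>
  have G_False: "G (False # v) = ennreal \<rho> * G v" for v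
  proof -
    have "A (False # v) * (r powr (1 - a)) powr p = \<rho> * A v"
    proof -
      have "(r powr (1 - a)) powr p = r powr p * r powr - (a * p)"
        by (simp add: powr_powr powr_add[symmetric] left_diff_distrib)
      moreover have "\<rho> = r * r powr - (a * p)"
        using r powr_add[of r 1 "- (a * p)"] by (simp add: \<rho>_def)
      ultimately show ?thesis
        using r mu_pos[of v] by (simp add: A_def mu_False lam_def powr_mult)
    qed
    hence "ennreal (A (False # v)) * ennreal ((r powr (1 - a)) powr p) = ennreal \<rho> * ennreal (A v)"
      using A_pos \<rho> by (simp add: ennreal_mult[symmetric] less_imp_le)
    moreover have "ennpowr (S (False # v)) p = ennreal ((r powr (1 - a)) powr p) * ennpowr (S v) p"
      unfolding S_False by (rule ennpowr_cmult) (use r p in auto)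
    ultimately show ?thesis
      unfolding G_def by (metis mult.assoc)
  qed
  have G_Nil: "ennreal ((1 - t) * (1 - r) * s0 powr p) \<le> G []"
  proof -
    \<comment> \<open>Total mass at most 1 gives \<open>A [] \<ge> lam []\<close>.\<close>
    have "mu [] powr p \<le> 1"
      using mu_Nil mu_pos[of "[]"] p by (intro powr_le1) auto
    hence "(1 - t) * (1 - r) \<le> A []"
      using mu_pos[of "[]"] r t by (simp add: A_def lam_def pos_le_divide_eq mult_left_le)
    moreover have "ennreal (s0 powr p) \<le> ennpowr (S []) p"
      using ennpowr_mono[OF S_Nil, of p] p r a by (simp add: ennpowr_ennreal s0_def)
    ultimately have "ennreal ((1 - t) * (1 - r)) * ennreal (s0 powr p) \<le> G []"
      unfolding G_def by (intro mult_mono ennreal_leI) auto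
    thus ?thesis
      using r t by (simp add: ennreal_mult[symmetric])
  qed
  have lower: "ennreal ((1 - t) * (1 - r) * s0 powr p / (1 - \<rho>)) \<le> subtree_sum G []"
    by (rule subtree_sum_geometric_ge[OF G_False \<rho> _ G_Nil]) (use r t in auto)
  have upper: "subtree_sum (\<lambda>v. ennreal (f v powr p * lam v)) [] \<le> ennreal ((1 - r) / (1 - \<rho>))"
    using branch_sum_le[OF r t(1,2)] \<rho> by (simp add: f_def lam_def \<rho>_def)

  have "\<not> tree_T p p' A lam C"
  proof
    assume T: "tree_T p p' A lam C"
    define \<phi> where "\<phi> v = f v * lam v powr (1 / p)" for v
    have \<phi>_pos: "0 < \<phi> v" for v
      using f_pos[of v] lam_pos[of v] by (simp add: \<phi>_def)
    have \<phi>_powr: "\<phi> v powr p = f v powr p * lam v" for v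
      using f_pos[of v] lam_pos[of v] p by (simp add: \<phi>_def powr_mult powr_powr)
    have \<phi>_lam: "\<phi> v * lam v powr (1 / p') = f v * lam v" for v
      using p(2) lam_pos[of v] by (simp add: \<phi>_def mult.assoc powr_add[symmetric])
    have "subtree_sum (\<lambda>v. ennreal (\<phi> v powr p)) [] < \<infinity>"
      unfolding \<phi>_powr using upper by (rule le_less_trans) simp
    hence "subtree_sum G [] \<le> ennreal C * subtree_sum (\<lambda>v. ennreal (f v powr p * lam v)) []"
      using T \<phi>_pos unfolding tree_T_def G_def S_def \<phi>_powr[symmetric] \<phi>_lam[symmetric] by blast
    also have "\<dots> \<le> ennreal C * ennreal ((1 - r) / (1 - \<rho>))"
      by (intro mult_left_mono upper) simp
    also have "\<dots> = ennreal (C * ((1 - r) / (1 - \<rho>)))"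
      using C by (simp only: ennreal_mult' less_imp_le)
    finally have "ennreal ((1 - t) * (1 - r) * s0 powr p / (1 - \<rho>)) \<le> ennreal (C * ((1 - r) / (1 - \<rho>)))"
      using lower by (rule order_trans[rotated])
    hence "(1 - t) * (1 - r) * s0 powr p / (1 - \<rho>) \<le> C * ((1 - r) / (1 - \<rho>))"
      using C r \<rho> by (subst (asm) ennreal_le_iff) auto
    hence "((1 - t) * s0 powr p) * ((1 - r) / (1 - \<rho>)) \<le> C * ((1 - r) / (1 - \<rho>))"
      by (simp add: mult_ac)
    hence "(1 - t) * s0 powr p \<le> C"
      using r \<rho> by (subst (asm) mult_le_cancel_right_pos) auto
    thus False
      using C_less by (simp add: s0_def r_def a_def)
  qed
  thus ?thesis
    using that A_pos lam_pos H by blast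
qed

section \<open>Transfer to dyadic intervals\<close>

text \<open>For nonnegative terms the extended sum is the supremum of the finite partial sums, and
  boundedness of these is summability over the reals.\<close>

lemma in_lp_iff:
  assumes I: "bounded_interval I" and \<phi>: "\<And>v. 0 < \<phi> (node I v)"
  shows "in_lp p I \<phi> \<longleftrightarrow> subtree_sum (\<lambda>v. ennreal (\<phi> (node I v) powr p)) [] < \<infinity>"
proof -
  define g where "g v = \<phi> (node I v) powr p" for v
  have g_nonneg: "0 \<le> g v" for v
    by (simp add: g_def)
  have "in_lp p I \<phi> \<longleftrightarrow> g summable_on UNIV"
    unfolding in_lp_def dyadic_eq_range_node summable_on_reindex[OF inj_node[OF I]]
    using \<phi> by (simp add: o_def g_def[abs_def] less_imp_le)
  also have "\<dots> \<longleftrightarrow> subtree_sum (\<lambda>v. ennreal (g v)) [] < \<infinity>"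
  proof
    assume "g summable_on UNIV"
    hence "ennreal (infsum g UNIV) = subtree_sum (\<lambda>v. ennreal (g v)) []"
      using g_nonneg by (simp add: infsum_nonneg_is_SUPREMUM_ennreal subtree_sum_def
          nonneg_infsum_complete)
    thus "subtree_sum (\<lambda>v. ennreal (g v)) [] < \<infinity>"
      by (metis ennreal_less_top infinity_ennreal_def)
  next
    assume fin: "subtree_sum (\<lambda>v. ennreal (g v)) [] < \<infinity>"
    have "sum g X \<le> real_sum g []" if "finite X" for X
    proof -
      have "(\<Sum>v\<in>X. ennreal (g v)) \<le> subtree_sum (\<lambda>v. ennreal (g v)) []"
        unfolding subtree_sum_def infsum_finite[OF that, symmetric]
        by (rule infsum_mono_neutral) (auto simp: ennreal_summable_on)
      thus ?thesis
        by (simp add: ennreal_real_sum[OF fin] g_nonneg real_sum_nonneg)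
    qed
    thus "g summable_on UNIV"
      using g_nonneg by (intro nonneg_bdd_above_summable_on bdd_aboveI[where M = "real_sum g []"]) auto
  qed
  finally show ?thesis
    by (simp add: g_def)
qed

lemma cond_T_iff_tree_T:
  assumes I: "bounded_interval I" and p: "0 < p" and \<alpha>: "\<And>v. 0 \<le> \<alpha> (node I v)"
  shows "cond_T p p' I \<alpha> lam C \<longleftrightarrow>
    tree_T p p' (tree_weight p I \<alpha>) (\<lambda>v. lam (node I v)) C"
proof -
  define T where "T f \<longleftrightarrow> subtree_sum (\<lambda>v. ennreal (tree_weight p I \<alpha> v) *
        ennpowr (subtree_sum (\<lambda>w. ennreal (f w * lam (node I w) powr (1 / p'))) v) p) []
      \<le> ennreal C * subtree_sum (\<lambda>v. ennreal (f v powr p)) []" for f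
  have cancel: "ennreal (1 / len I) * x \<le> ennreal C * (ennreal (1 / len I) * y) \<longleftrightarrow>
      x \<le> ennreal C * y" for x y
    using I by (subst mult.left_commute)
      (auto simp: bounded_interval_def ennreal_mult_le_mult_iff)
  have T_iff: "tree_avg I (\<lambda>K. ennreal (\<alpha> K) *
          ennpowr (tree_avg K (\<lambda>J. ennreal (\<phi> J * lam J powr (1 / p')))) p)
        \<le> ennreal C * tree_avg I (\<lambda>K. ennreal (\<phi> K powr p)) \<longleftrightarrow> T (\<lambda>v. \<phi> (node I v))" for \<phi>
    using tree_avg_power_eq[of I p \<alpha> "[]"] tree_avg_node[of I "[]"] assms cancel
    by (simp add: T_def)
  show ?thesis
  proof
    assume L: "cond_T p p' I \<alpha> lam C"
    have "T f" if f: "\<forall>v. 0 < f v" "subtree_sum (\<lambda>v. ennreal (f v powr p)) [] < \<infinity>" for f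
    proof -
      \<comment> \<open>A test function on words is carried to the intervals by the inverse of the
        injective addressing.\<close>
      define \<phi> where "\<phi> K = f (inv (node I) K)" for K
      have \<phi>_node: "\<phi> (node I v) = f v" for v
        using inj_node[OF I] by (simp add: \<phi>_def)
      have "\<phi> \<in> dyadic I \<rightarrow> {0<..}" "in_lp p I \<phi>"
        using f by (auto simp: in_lp_iff[OF I] \<phi>_node dyadic_eq_range_node)
      thus ?thesis
        using L T_iff[of \<phi>] by (simp add: cond_T_def \<phi>_node)
    qed
    thus "tree_T p p' (tree_weight p I \<alpha>) (\<lambda>v. lam (node I v)) C"
      by (simp add: tree_T_def T_def)
  next
    assume R: "tree_T p p' (tree_weight p I \<alpha>) (\<lambda>v. lam (node I v)) C"
    have "T (\<lambda>v. \<phi> (node I v))" if "\<phi> \<in> dyadic I \<rightarrow> {0<..}" "in_lp p I \<phi>" for \<phi>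
    proof -
      have "0 < \<phi> (node I v)" for v
        using that(1) by (auto simp: dyadic_eq_range_node)
      thus ?thesis
        using that(2) R in_lp_iff[OF I, of \<phi> p] by (simp add: tree_T_def T_def)
    qed
    thus "cond_T p p' I \<alpha> lam C"
      by (simp add: cond_T_def T_iff)
  qed
qed

lemma tree_weight_pos:
  assumes "bounded_interval I" "\<And>v. 0 < \<alpha> (node I v)"
  shows "0 < tree_weight p I \<alpha> v"
  using assms by (simp add: tree_weight_def bounded_interval_def)

theorem theorem0p1:
  fixes p p' :: real and I0 :: "real set"
  assumes "1 < p" and "1 / p + 1 / p' = 1"
    and "is_interval I0" and "bounded I0" and "0 < len I0"
  shows "(\<forall>\<alpha> lam. \<alpha> \<in> dyadic I0 \<rightarrow> {0<..} \<longrightarrow> lam \<in> dyadic I0 \<rightarrow> {0<..} \<longrightarrow>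
            cond_H p I0 \<alpha> lam \<longrightarrow> cond_T p p' I0 \<alpha> lam (sharp_const p))
    \<and> (\<forall>C. 0 < C \<longrightarrow> C < sharp_const p \<longrightarrow>
          (\<exists>\<alpha> lam. \<alpha> \<in> dyadic I0 \<rightarrow> {0<..} \<and> lam \<in> dyadic I0 \<rightarrow> {0<..} \<and>
            cond_H p I0 \<alpha> lam \<and> \<not> cond_T p p' I0 \<alpha> lam C))
    \<and> (\<forall>\<alpha> lam. \<alpha> \<in> dyadic I0 \<rightarrow> {0<..} \<longrightarrow> lam \<in> dyadic I0 \<rightarrow> {0<..} \<longrightarrow>
          cond_T p p' I0 \<alpha> lam 1 \<longrightarrow> cond_H p I0 \<alpha> lam)"
proof (intro conjI allI impI)
  have I: "bounded_interval I0"
    using assms by (simp add: bounded_interval_def)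
  have pos_iff: "\<alpha> \<in> dyadic I0 \<rightarrow> {0<..} \<longleftrightarrow> (\<forall>v. 0 < \<alpha> (node I0 v))" for \<alpha> :: "real set \<Rightarrow> real"
    by (auto simp: dyadic_eq_range_node)
  have H_iff: "cond_H p I0 \<alpha> lam \<longleftrightarrow> tree_H p (tree_weight p I0 \<alpha>) (\<lambda>v. lam (node I0 v))"
    and T_iff: "cond_T p p' I0 \<alpha> lam C \<longleftrightarrow> tree_T p p' (tree_weight p I0 \<alpha>) (\<lambda>v. lam (node I0 v)) C"
    if "\<alpha> \<in> dyadic I0 \<rightarrow> {0<..}" for \<alpha> lam C
    using that assms(1) cond_H_iff_tree_H[OF I, of p \<alpha>] cond_T_iff_tree_T[OF I, of p \<alpha>]
    by (auto simp: pos_iff less_imp_le)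
  show "cond_T p p' I0 \<alpha> lam (sharp_const p)"
    if "\<alpha> \<in> dyadic I0 \<rightarrow> {0<..}" "lam \<in> dyadic I0 \<rightarrow> {0<..}" "cond_H p I0 \<alpha> lam" for \<alpha> lam
    using tree_H_imp_tree_T[OF assms(1,2), of "tree_weight p I0 \<alpha>" "\<lambda>v. lam (node I0 v)"]
      that tree_weight_pos[OF I] H_iff[OF that(1)] T_iff[OF that(1)]
    by (simp add: pos_iff sharp_const_def)
  show "cond_H p I0 \<alpha> lam"
    if "\<alpha> \<in> dyadic I0 \<rightarrow> {0<..}" "lam \<in> dyadic I0 \<rightarrow> {0<..}" "cond_T p p' I0 \<alpha> lam 1" for \<alpha> lam
    using tree_T_imp_tree_H[OF assms(1,2), of "tree_weight p I0 \<alpha>" "\<lambda>v. lam (node I0 v)"]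
      that tree_weight_pos[OF I] H_iff[OF that(1)] T_iff[OF that(1)]
    by (simp add: pos_iff)
  show "\<exists>\<alpha> lam. \<alpha> \<in> dyadic I0 \<rightarrow> {0<..} \<and> lam \<in> dyadic I0 \<rightarrow> {0<..} \<and>
      cond_H p I0 \<alpha> lam \<and> \<not> cond_T p p' I0 \<alpha> lam C"
    if C: "0 < C" "C < sharp_const p" for C
  proof -
    obtain A l where A: "\<And>v. 0 < A v" "\<And>v. 0 < l v" "tree_H p A l" "\<not> tree_T p p' A l C"
      using tree_T_sharp[OF assms(1,2) C(1) C(2)[unfolded sharp_const_def]] by blast
    let ?addr = "inv (node I0)"
    \<comment> \<open>The divisor undoes the factor that \<open>tree_weight\<close> multiplies in,
      so that the weight on the tree is exactly \<open>A\<close>.\<close>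
    define \<alpha> where "\<alpha> K = A (?addr K) / (2 ^ length (?addr K) / len I0) powr p" for K
    define lam where "lam K = l (?addr K)" for K
    have addr: "?addr (node I0 v) = v" for v
      using inj_node[OF I] by simp
    have lam_node: "(\<lambda>v. lam (node I0 v)) = l" and weight: "tree_weight p I0 \<alpha> = A"
      using assms(5) by (simp_all add: fun_eq_iff lam_def tree_weight_def \<alpha>_def addr)
    have \<alpha>_pos: "\<alpha> \<in> dyadic I0 \<rightarrow> {0<..}"
      using A(1) assms(5) by (simp add: pos_iff \<alpha>_def addr)
    moreover have "lam \<in> dyadic I0 \<rightarrow> {0<..}"
      using A(2) by (simp add: pos_iff lam_def)
    moreover have "cond_H p I0 \<alpha> lam" "\<not> cond_T p p' I0 \<alpha> lam C"
      using A(3,4) unfolding H_iff[OF \<alpha>_pos] T_iff[OF \<alpha>_pos] lam_node weight by blast+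
    ultimately show ?thesis by blast
  qed
qed

end
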